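(* Let $\mathcal{G}:\mathcal{P}\times\mathcal{T}\to\mathbb{R}^{N_h}$, $(\boldsymbol{\mu},t)\mapsto\mathbf{u}(\boldsymbol{\mu},t)$, be a parameter-to-solution map satisfying the sampling criterion and the parameter-to-solution-map assumption described in the context. Consider a POD+DNN approximation $\mathcal{G}(\boldsymbol{\mu},t)\approx\mathbf{V}\hat{\mathbf{q}}(\boldsymbol{\mu},t)$, where $\hat{\mathbf{q}}:\mathbb{R}^{p+1}\to\mathbb{R}^N$ is a neural network trained over the training set of $N_{data}=N_sN_t$ input parameters and the corresponding snapshot matrix $\mathbf{U}\in\mathbb{R}^{N_h\times N_{data}}$, and $\mathbf{V}\in\mathbb{R}^{N_h\times N}$ is the POD projection matrix. Then $$\mathcal{E}_R\le\mathcal{E}_S+\mathcal{E}_{POD}+\mathcal{E}_{NN},$$ where the error $\mathcal{E}_R$ and the three terms on the right are defined in the context, and: 1. the sampling error $\mathcal{E}_S$, which depends only on $\mathcal{G}$, the training parameters and $N$, satisfies $\mathcal{E}_S\to 0$ almost surely as $N_s,N_t\to\infty$, and $\mathbb{E}[\mathcal{E}_S]=O(N_s^{-1/4}+N_t^{-1/2})$; 2. the POD projection error $\mathcal{E}_{POD}$, which depends only on $\mathcal{G}$, the training parameters and $N$, satisfies $\mathcal{E}_{POD}\to\mathcal{E}_{POD,\infty}$ almost surely as $N_s,N_t\to\infty$, where $\mathcal{E}_{POD,\infty}$ depends only on $\mathcal{G}$ and $N$ (it is independent of the sampling criterion); 3. the neural network error $\mathcal{E}_{NN}$ is the only term depending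 on $\hat{\mathbf{q}}$, and it can be made arbitrarily small by a suitable choice of the network: for every $\eta>0$ there is a neural network $\hat{\mathbf{q}}:\mathbb{R}^{p+1}\to\mathbb{R}^N$ for which $\mathcal{E}_{NN}<\eta$.
   Context: Notation: $\|\cdot\|$ is the Euclidean norm, $|\mathcal{P}\times\mathcal{T}|$ is the Lebesgue measure of $\mathcal{P}\times\mathcal{T}$, and $1\le N\le N_h$ is a fixed integer (POD dimension), with $N_h\in\mathbb{N}$ fixed. Sampling criterion: $p>0$, $\mathcal{P}\subset\mathbb{R}^p$ is compact (with positive measure, so that the uniform law $\mathcal{U}(\mathcal{P})$ is defined), $\mathcal{T}=[0,T]$ with $T>0$. Parameters $\boldsymbol{\mu}_1,\dots,\boldsymbol{\mu}_{N_s}$ are drawn i.i.d. from $\mathcal{U}(\mathcal{P})$; times are taken on the uniform grid $t_k=k\Delta t$, $k=1,\dots,N_t$, with $N_t\ge 2$, $\Delta t=T/N_t$. The training set consists of all $N_{data}=N_sN_t$ pairs $(\boldsymbol{\mu}_j,t_k)$. Expectations and almost sure statements refer to the random sampling. Parameter-to-solution-map assumption: $m=\operatorname{ess\,inf}_{\mathcal{P}\times\mathcal{T}}\|\mathbf{u}(\boldsymbol{\mu},t)\|>0$, $M=\operatorname{ess\,sup}_{\mathcal{P}\times\mathcal{T}}\|\mathbf{u}(\boldsymbol{\mu},t)\|<\infty$, and $\mathcal{G}$ is Lipschitz-continuous with constant $L>0$. POD: $\mathbf{U}\in\mathbb{R}^{N_h\times N_{data}}$ is the matrix whose columns are the snapshots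 $\mathbf{u}(\boldsymbol{\mu}_j,t_k)$; $\mathbf{V}\in\mathbb{R}^{N_h\times N}$ has as columns the first $N$ left singular vectors of $\mathbf{U}$ (so $\mathbf{V}^T\mathbf{V}=\mathbf{I}$). The discrete correlation matrix is $\mathbf{K}=\frac{|\mathcal{P}\times\mathcal{T}|}{N_{data}}\mathbf{U}\mathbf{U}^T\in\mathbb{R}^{N_h\times N_h}$, with eigenvalues $\sigma_1^2\ge\sigma_2^2\ge\dots\ge\sigma_{N_h}^2\geq 0$. The continuous correlation matrix is $\mathbf{K}_\infty=\int_{\mathcal{P}\times\mathcal{T}}\mathbf{u}(\boldsymbol{\mu},t)\mathbf{u}(\boldsymbol{\mu},t)^T\,d(\boldsymbol{\mu},t)$, with eigenvalues $\sigma_{1,\infty}^2\ge\dots\ge\sigma_{N_h,\infty}^2\geq 0$. Put $\mathbf{q}(\boldsymbol{\mu},t)=\mathbf{V}^T\mathbf{u}(\boldsymbol{\mu},t)$. Errors: $$\mathcal{E}_R=\Big(\int_{\mathcal{P}\times\mathcal{T}}\frac{\|\mathbf{u}(\boldsymbol{\mu},t)-\mathbf{V}\hat{\mathbf{q}}(\boldsymbol{\mu},t)\|^2}{\|\mathbf{u}(\boldsymbol{\mu},t)\|^2}\,d(\boldsymbol{\mu},t)\Big)^{1/2},\qquad \mathcal{E}_{NN}=\Big(\int_{\mathcal{P}\times\mathcal{T}}\frac{\|\mathbf{V}\mathbf{q}(\boldsymbol{\mu},t)-\mathbf{V}\hat{\mathbf{q}}(\boldsymbol{\mu},t)\|^2}{\|\mathbf{u}(\boldsymbol{\mu},t)\|^2}\,d(\boldsymbol{\mu},t)\Big)^{1/2},$$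 $$\mathcal{E}_S=m^{-1}\Big|\int_{\mathcal{P}\times\mathcal{T}}\|\mathbf{u}(\boldsymbol{\mu},t)-\mathbf{V}\mathbf{V}^T\mathbf{u}(\boldsymbol{\mu},t)\|^2\,d(\boldsymbol{\mu},t)-\sum_{k>N}\sigma_k^2\Big|^{1/2},$$ $$\mathcal{E}_{POD}=m^{-1}\sqrt{\sum_{k>N}\sigma_k^2},\qquad \mathcal{E}_{POD,\infty}=m^{-1}\sqrt{\sum_{k>N}\sigma_{k,\infty}^2}.$$ A neural network is a feedforward network, i.e. a finite composition of affine maps and componentwise continuous activation functions (e.g. ReLU, $x\mapsto\max\{x,0\}$). *)

theory Defs
  imports "HOL-Probability.Probability" "HOL-Computational_Algebra.Computational_Algebra"
begin

text \<open>
  A solution map is a function \<open>u\<close> on \<open>(real ^ 'p) \<times> real\<close> of which only the restriction to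
  \<open>P \<times> {0..T}\<close> matters. The number of degrees of freedom is \<open>CARD('h)\<close>, the POD dimension
  is \<open>CARD('n)\<close>. Samples, times, singular values and eigenvalues are numbered from 1.
\<close>

definition essinf :: "'a measure \<Rightarrow> ('a \<Rightarrow> real) \<Rightarrow> ereal" where
  "essinf M f = - esssup M (\<lambda>x. - ereal (f x))"

definition charpoly :: "real ^ 'n ^ 'n \<Rightarrow> real poly" where
  "charpoly A = det (\<chi> i j. (if i = j then [:0, 1:] else 0) - [:A $ i $ j:])"

text \<open>The \<open>k\<close>-th largest real eigenvalue, counted with algebraic multiplicity. Only
  meaningful for \<open>1 \<le> k \<le> CARD('n)\<close> and real-rooted matrices, such as symmetric ones.\<close>

definition eigval :: "real ^ 'n ^ 'n \<Rightarrow> nat \<Rightarrow> real" where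
  "eigval A k = rev (sorted_list_of_multiset (proots (charpoly A))) ! (k - 1)"

text \<open>
  A matrix with \<open>CARD('h)\<close> rows whose columns are indexed by a finite set \<open>J\<close> is
  represented by its family of columns \<open>U c\<close>, \<open>c \<in> J\<close>. The following is the full singular
  value decomposition \<open>U = W S Z\<^sup>T\<close>: \<open>w i\<close> are the columns of \<open>W\<close>, \<open>z i\<close> those of \<open>Z\<close>, and
  \<open>s i\<close> the diagonal entries of \<open>S\<close>.
\<close>

definition is_svd :: "'c set \<Rightarrow> ('c \<Rightarrow> real ^ 'h) \<Rightarrow>
    (nat \<Rightarrow> real ^ 'h) \<Rightarrow> (nat \<Rightarrow> real) \<Rightarrow> (nat \<Rightarrow> 'c \<Rightarrow> real) \<Rightarrow> bool" where
  "is_svd J U w s z \<longleftrightarrow>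
     (\<forall>i\<in>{1..CARD('h)}. \<forall>j\<in>{1..CARD('h)}. w i \<bullet> w j = (if i = j then 1 else 0)) \<and>
     (\<forall>i\<in>{1..card J}. \<forall>j\<in>{1..card J}. (\<Sum>c\<in>J. z i c * z j c) = (if i = j then 1 else 0)) \<and>
     (\<forall>i\<in>{1..min CARD('h) (card J)}. 0 \<le> s i) \<and>
     (\<forall>i\<in>{1..min CARD('h) (card J)}. \<forall>j\<in>{1..min CARD('h) (card J)}. i \<le> j \<longrightarrow> s j \<le> s i) \<and>
     (\<forall>c\<in>J. U c = (\<Sum>i = 1..min CARD('h) (card J). (s i * z i c) *\<^sub>R w i))"

text \<open>The columns of \<open>V\<close> are the first \<open>CARD('n)\<close> left singular vectors of \<open>U\<close>. The
  bijection \<open>e\<close> numbers the columns of \<open>V\<close>, since \<open>'n\<close> carries no order.\<close>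

definition is_pod_matrix :: "'c set \<Rightarrow> ('c \<Rightarrow> real ^ 'h) \<Rightarrow> real ^ 'n ^ 'h \<Rightarrow> bool" where
  "is_pod_matrix J U V \<longleftrightarrow>
     (\<exists>w s z e. is_svd J U w s z \<and> bij_betw e (UNIV :: 'n set) {1..CARD('n)} \<and>
        (\<forall>k. column k V = w (e k)))"

text \<open>The snapshot matrix; column \<open>(j, k)\<close> is \<open>u(\<theta>\<^sub>j, t\<^sub>k)\<close> with \<open>t\<^sub>k = k T / N\<^sub>t\<close>. The value 0
  outside the index range makes it depend on \<open>\<theta> 1, \<dots>, \<theta> Ns\<close> only.\<close>

definition snapshots :: "real \<Rightarrow> ((real ^ 'p) \<times> real \<Rightarrow> real ^ 'h) \<Rightarrow> nat \<Rightarrow> nat \<Rightarrow>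
    (nat \<Rightarrow> real ^ 'p) \<Rightarrow> nat \<times> nat \<Rightarrow> real ^ 'h" where
  "snapshots T u Ns Nt \<theta> = (\<lambda>(j, k).
     if j \<in> {1..Ns} \<and> k \<in> {1..Nt} then u (\<theta> j, real k * (T / real Nt)) else 0)"

definition corr_matrix :: "(real ^ 'p) set \<Rightarrow> real \<Rightarrow> ((real ^ 'p) \<times> real \<Rightarrow> real ^ 'h) \<Rightarrow>
    nat \<Rightarrow> nat \<Rightarrow> (nat \<Rightarrow> real ^ 'p) \<Rightarrow> real ^ 'h ^ 'h" where
  "corr_matrix P T u Ns Nt \<theta> =
     (measure lborel (P \<times> {0..T}) / real (Ns * Nt)) *\<^sub>R
       (\<chi> a b. \<Sum>c\<in>{1..Ns} \<times> {1..Nt}. snapshots T u Ns Nt \<theta> c $ a * snapshots T u Ns Nt \<theta> c $ b)"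

definition corr_matrix_inf :: "(real ^ 'p) set \<Rightarrow> real \<Rightarrow> ((real ^ 'p) \<times> real \<Rightarrow> real ^ 'h) \<Rightarrow>
    real ^ 'h ^ 'h" where
  "corr_matrix_inf P T u = (\<chi> a b. LINT x:P \<times> {0..T}|lborel. u x $ a * u x $ b)"

definition sol_essinf :: "(real ^ 'p) set \<Rightarrow> real \<Rightarrow> ((real ^ 'p) \<times> real \<Rightarrow> real ^ 'h) \<Rightarrow> ereal" where
  "sol_essinf P T u = essinf (restrict_space lborel (P \<times> {0..T})) (\<lambda>x. norm (u x))"

definition sol_esssup :: "(real ^ 'p) set \<Rightarrow> real \<Rightarrow> ((real ^ 'p) \<times> real \<Rightarrow> real ^ 'h) \<Rightarrow> ereal" where
  "sol_esssup P T u = esssup (restrict_space lborel (P \<times> {0..T})) (\<lambda>x. ereal (norm (u x)))"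

definition err_R :: "(real ^ 'p) set \<Rightarrow> real \<Rightarrow> ((real ^ 'p) \<times> real \<Rightarrow> real ^ 'h) \<Rightarrow>
    real ^ 'n ^ 'h \<Rightarrow> ((real ^ 'p) \<times> real \<Rightarrow> real ^ 'n) \<Rightarrow> real" where
  "err_R P T u V q =
     sqrt (LINT x:P \<times> {0..T}|lborel. (norm (u x - V *v q x))\<^sup>2 / (norm (u x))\<^sup>2)"

definition err_NN :: "(real ^ 'p) set \<Rightarrow> real \<Rightarrow> ((real ^ 'p) \<times> real \<Rightarrow> real ^ 'h) \<Rightarrow>
    real ^ 'n ^ 'h \<Rightarrow> ((real ^ 'p) \<times> real \<Rightarrow> real ^ 'n) \<Rightarrow> real" where
  "err_NN P T u V q =
     sqrt (LINT x:P \<times> {0..T}|lborel.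
       (norm (V *v (transpose V *v u x) - V *v q x))\<^sup>2 / (norm (u x))\<^sup>2)"

definition err_S :: "(real ^ 'p) set \<Rightarrow> real \<Rightarrow> ((real ^ 'p) \<times> real \<Rightarrow> real ^ 'h) \<Rightarrow>
    real ^ 'n ^ 'h \<Rightarrow> nat \<Rightarrow> nat \<Rightarrow> (nat \<Rightarrow> real ^ 'p) \<Rightarrow> real" where
  "err_S P T u V Ns Nt \<theta> =
     inverse (real_of_ereal (sol_essinf P T u)) *
     sqrt \<bar>(LINT x:P \<times> {0..T}|lborel. (norm (u x - V *v (transpose V *v u x)))\<^sup>2)
           - (\<Sum>k = CARD('n) + 1..CARD('h). eigval (corr_matrix P T u Ns Nt \<theta>) k)\<bar>"

definition err_POD :: "(real ^ 'p) set \<Rightarrow> real \<Rightarrow> ((real ^ 'p) \<times> real \<Rightarrow> real ^ 'h) \<Rightarrow>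
    nat \<Rightarrow> nat \<Rightarrow> nat \<Rightarrow> (nat \<Rightarrow> real ^ 'p) \<Rightarrow> real" where
  "err_POD P T u N Ns Nt \<theta> =
     inverse (real_of_ereal (sol_essinf P T u)) *
     sqrt (\<Sum>k = N + 1..CARD('h). eigval (corr_matrix P T u Ns Nt \<theta>) k)"

definition err_POD_inf :: "(real ^ 'p) set \<Rightarrow> real \<Rightarrow> ((real ^ 'p) \<times> real \<Rightarrow> real ^ 'h) \<Rightarrow>
    nat \<Rightarrow> real" where
  "err_POD_inf P T u N =
     inverse (real_of_ereal (sol_essinf P T u)) *
     sqrt (\<Sum>k = N + 1..CARD('h). eigval (corr_matrix_inf P T u) k)"

text \<open>
  \<open>ffn_layer d f\<close>: the map \<open>f\<close> from the input space to the state of a layer of width \<open>d\<close>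
  (entries \<open>0, \<dots>, d - 1\<close>; the others are irrelevant) is a finite composition of affine maps
  and componentwise continuous activations. Layer widths are arbitrary, hence the
  states are functions on \<open>nat\<close> rather than elements of a type \<open>real ^ 'k\<close>.
\<close>

inductive ffn_layer :: "nat \<Rightarrow> ('a::euclidean_space \<Rightarrow> nat \<Rightarrow> real) \<Rightarrow> bool" where
  input_affine: "ffn_layer d (\<lambda>x i. a i \<bullet> x + b i)"
| affine: "ffn_layer d f \<Longrightarrow> ffn_layer d' (\<lambda>x i. (\<Sum>j<d. W i j * f x j) + b i)"
| activation: "ffn_layer d f \<Longrightarrow> continuous_on UNIV \<rho> \<Longrightarrow> ffn_layer d (\<lambda>x i. \<rho> (f x i))"

definition neural_network :: "('a::euclidean_space \<Rightarrow> real ^ 'n) \<Rightarrow> bool" where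
  "neural_network q \<longleftrightarrow>
     (\<exists>f e. ffn_layer CARD('n) f \<and> bij_betw e (UNIV :: 'n set) {..<CARD('n)} \<and>
        (\<forall>x i. q x $ i = f x (e i)))"

end

theory Submission
  imports Defs
begin

unbundle no fps_syntax

text \<open>
  Write \<open>Q = I - V V\<^sup>T\<close> and let \<open>A \<bullet> B\<close> be the Frobenius inner product. The projection error
  \<open>\<integral> \<parallel>u - V V\<^sup>T u\<parallel>\<^sup>2\<close> equals \<open>K\<^sub>\<infinity> \<bullet> Q\<close> and, \<open>V\<close> consisting of leading eigenvectors of \<open>K\<close>,
  the tail \<open>\<Sum>k>N. \<sigma>\<^sub>k\<^sup>2\<close> equals \<open>K \<bullet> Q\<close>. So the sampling error is
  \<open>m\<^sup>-\<^sup>1 \<bar>(K\<^sub>\<infinity> - K) \<bullet> Q\<bar>\<^sup>1\<^sup>/\<^sup>2\<close>, controlled by \<open>\<parallel>K - K\<^sub>\<infinity>\<parallel>\<close>. By Ky Fan's minimum principle the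
  tail is the minimum of \<open>K \<bullet> Q\<close> over all \<open>V\<close> with orthonormal columns, hence it is Lipschitz in \<open>K\<close>.
  Each entry of \<open>K\<close> is an empirical mean over the parameters of Riemann sums in time: the Riemann
  sums contribute \<open>O(1/N\<^sub>t)\<close>, the empirical mean \<open>O(N\<^sub>s\<^sup>-\<^sup>1\<^sup>/\<^sup>2)\<close> in expectation, and it converges
  almost surely by Hoeffding's inequality and Borel-Cantelli.
\<close>

section \<open>Orthonormal eigenbases\<close>

text \<open>\<open>V\<close> depends on the random sample, so no estimate may be tied to a fixed
  projection: the bound on \<open>coproj V\<close> is uniform over all matrices with orthonormal
  columns. The eigenvalues of the statement are roots of a characteristic polynomial, while the
  argument needs eigenvectors; \<open>eigval_eigbasis\<close> is the bridge, and the eigenbases come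
  from the singular value decompositions that the hypothesis on \<open>pod\<close> provides. For a
  joint limit, a law of large numbers for each \<open>Nt\<close> separately would not be enough. The
  random variables are therefore exact time integrals, free of \<open>Nt\<close>, and the Riemann
  error is deterministic and uniform over the sample. Square roots halve both rates, whence the
  exponents -1/2 and -1/4. In the error decomposition only the projection part trades the weight
  \<open>1 / (norm (u x))\<^sup>2\<close> for \<open>1 / m\<^sup>2\<close>; the network part keeps
  it and is exactly \<open>err_NN\<close>.\<close>

definition onb :: "(nat \<Rightarrow> real ^ 'h) \<Rightarrow> bool" where
  "onb w \<longleftrightarrow> (\<forall>i\<in>{1..CARD('h)}. \<forall>j\<in>{1..CARD('h)}. w i \<bullet> w j = (if i = j then 1 else 0))"

text \<open>Eigenvalues travel with their eigenvectors and in decreasing order, so the index of a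
  singular vector is also the rank of its eigenvalue.\<close>

definition eigbasis :: "real ^ 'h ^ 'h \<Rightarrow> (nat \<Rightarrow> real ^ 'h) \<Rightarrow> (nat \<Rightarrow> real) \<Rightarrow> bool" where
  "eigbasis A w l \<longleftrightarrow> onb w \<and> (\<forall>i\<in>{1..CARD('h)}. A *v w i = l i *\<^sub>R w i) \<and>
     (\<forall>i\<in>{1..CARD('h)}. \<forall>j\<in>{1..CARD('h)}. i \<le> j \<longrightarrow> l j \<le> l i)"

lemma onb_orthogonal_matrix:
  fixes w :: "nat \<Rightarrow> real ^ 'h"
  assumes "onb w" "bij_betw e (UNIV :: 'h set) {1..CARD('h)}"
  shows "orthogonal_matrix (\<chi> i j. w (e j) $ i)"
proof -
  have e: "e i \<in> {1..CARD('h)}" for i using assms(2) by (auto simp: bij_betw_def)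
  have "e i = e j \<longleftrightarrow> i = j" for i j using assms(2) by (auto simp: bij_betw_def inj_on_def)
  moreover have "column j (\<chi> i j. w (e j) $ i) = w (e j)" for j
    by (simp add: column_def vec_eq_iff)
  ultimately show ?thesis
    using assms(1) e unfolding onb_def orthogonal_matrix_orthonormal_columns
    by (auto simp: norm_eq_1 orthogonal_def)
qed

lemma ex_bij_UNIV_atLeastAtMost: "\<exists>e. bij_betw e (UNIV :: 'h::finite set) {1..CARD('h)}"
  by (rule finite_same_card_bij) auto

lemma sum_UNIV_bij: "bij_betw e (UNIV :: 'h set) {1..CARD('h)} \<Longrightarrow> (\<Sum>i=1..CARD('h). f i) = (\<Sum>j\<in>UNIV. f (e j))"
  by (simp add: sum.reindex_bij_betw)

text \<open>A square matrix with orthonormal columns also has orthonormal rows, so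
  \<open>transpose ?W\<close> preserves inner products.\<close>

lemma onb_parseval:
  fixes w :: "nat \<Rightarrow> real ^ 'h"
  assumes "onb w"
  shows "(\<Sum>i=1..CARD('h). (x \<bullet> w i) * (y \<bullet> w i)) = x \<bullet> y"
proof -
  obtain e where e: "bij_betw e (UNIV :: 'h set) {1..CARD('h)}" using ex_bij_UNIV_atLeastAtMost by blast
  let ?W = "\<chi> i j. w (e j) $ i"
  have W: "?W ** transpose ?W = mat 1"
    using onb_orthogonal_matrix[OF assms e] by (simp add: orthogonal_matrix_def)
  have c: "(transpose ?W *v z) $ j = z \<bullet> w (e j)" for z j
    by (simp add: matrix_vector_mult_def transpose_def inner_vec_def mult.commute)
  have "x \<bullet> y = x \<bullet> (?W *v (transpose ?W *v y))"
    by (simp only: matrix_vector_mul_assoc W matrix_vector_mul_lid)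
  also have "\<dots> = (transpose ?W *v x) \<bullet> (transpose ?W *v y)"
    by (simp only: transpose_matrix_vector dot_lmul_matrix)
  also have "\<dots> = (\<Sum>j\<in>UNIV. (x \<bullet> w (e j)) * (y \<bullet> w (e j)))"
    by (simp add: inner_vec_def[of "transpose _ *v _"] c del: transpose_matrix_vector)
  finally show ?thesis by (simp only: sum_UNIV_bij[OF e])
qed

text \<open>In coordinates the factor of \<open>A $ a $ b\<close> is the Parseval sum of the unit
  vectors of \<open>a\<close> and \<open>b\<close>.\<close>

lemma onb_trace:
  fixes w :: "nat \<Rightarrow> real ^ 'h"
  assumes "onb w"
  shows "(\<Sum>i=1..CARD('h). w i \<bullet> (A *v w i)) = trace A"
proof -
  have "(\<Sum>i=1..CARD('h). w i \<bullet> (A *v w i)) = 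
        (\<Sum>i=1..CARD('h). \<Sum>a\<in>UNIV. \<Sum>b\<in>UNIV. A $ a $ b * (w i $ a * w i $ b))"
    by (simp add: inner_vec_def matrix_vector_mult_def sum_distrib_left mult_ac)
  also have "\<dots> = (\<Sum>a\<in>UNIV. \<Sum>b\<in>UNIV. A $ a $ b * (\<Sum>i=1..CARD('h). (axis a 1 \<bullet> w i) * (axis b 1 \<bullet> w i)))"
    by (subst sum.swap, intro sum.cong refl, subst sum.swap)
       (simp add: sum_distrib_left inner_axis')
  also have "\<dots> = (\<Sum>a\<in>UNIV. \<Sum>b\<in>UNIV. if a = b then A $ a $ b else 0)"
    unfolding onb_parseval[OF assms] by (intro sum.cong refl) (auto simp: inner_axis_axis)
  finally show ?thesis by (simp add: trace_def)
qed

lemma poly_charpoly: "poly (charpoly A) x = det (mat x - A)"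
  by (simp add: charpoly_def det_def poly_sum poly_prod mat_def)
     (intro sum.cong refl arg_cong2[where f="(*)"] prod.cong; auto)

text \<open>Conjugating \<open>mat x - A\<close> by the eigenvector matrix makes it diagonal without
  changing its determinant. This is done at each real \<open>x\<close>, with real matrices; the
  values at all reals determine the polynomial.\<close>

lemma charpoly_eigbasis:
  fixes A :: "real ^ 'h ^ 'h"
  assumes "eigbasis A w l"
  shows "charpoly A = (\<Prod>i=1..CARD('h). [:- l i, 1:])"
proof -
  obtain e where e: "bij_betw e (UNIV :: 'h set) {1..CARD('h)}" using ex_bij_UNIV_atLeastAtMost by blast
  have eI: "e i \<in> {1..CARD('h)}" for i using e by (auto simp: bij_betw_def)
  have inj: "e i = e j \<longleftrightarrow> i = j" for i j using e by (auto simp: bij_betw_def inj_on_def)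
  define W where "W = (\<chi> i j. w (e j) $ i)"
  have onb: "onb w" using assms by (simp add: eigbasis_def)
  have W: "transpose W ** W = mat 1"
    using onb_orthogonal_matrix[OF _ e, of w] onb by (simp add: orthogonal_matrix_def W_def)
  have "poly (charpoly A) x = poly (\<Prod>i=1..CARD('h). [:- l i, 1:]) x" for x
  proof -
    define D where "D = transpose W ** (mat x - A) ** W"
    have "mat x *v v = x *\<^sub>R v" for v :: "real ^ 'h"
      by (simp add: vec_eq_iff matrix_vector_mult_def mat_def if_distrib[of "\<lambda>t. t * _"] cong: if_cong)
    then have col: "(mat x - A) *v w (e j) = (x - l (e j)) *\<^sub>R w (e j)" for j
      using assms eI by (simp add: eigbasis_def matrix_vector_mult_diff_rdistrib scaleR_diff_left)
    have "D $ i $ j = w (e i) \<bullet> ((mat x - A) *v w (e j))" for i j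
      by (simp add: D_def W_def matrix_matrix_mult_def transpose_def inner_vec_def matrix_vector_mult_def
         sum_distrib_left sum_distrib_right mult.assoc flip: matrix_mul_assoc) (rule sum.swap)
    then have D: "D $ i $ j = (if i = j then x - l (e j) else 0)" for i j
      using onb eI unfolding col onb_def by (simp add: inj)
    have "det D = (\<Prod>j\<in>UNIV. x - l (e j))"
      by (subst det_diagonal) (auto simp: D)
    moreover have "det D = det (mat x - A)"
      using arg_cong[OF W, of det] by (simp add: D_def det_mul)
    ultimately show ?thesis using prod.reindex_bij_betw[OF e, of "\<lambda>i. x - l i"]
      by (simp add: poly_charpoly poly_prod)
  qed
  then show ?thesis by (simp add: fun_eq_iff flip: poly_eq_poly_eq_iff)
qed

text \<open>Links the eigenvalues of the statement, defined as sorted roots, to those of an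
  arbitrary eigenbasis; in particular all eigenbases of \<open>A\<close> carry the same
  values.\<close>

lemma eigval_eigbasis:
  fixes A :: "real ^ 'h ^ 'h"
  assumes "eigbasis A w l" "k \<in> {1..CARD('h)}"
  shows "eigval A k = l k"
proof -
  let ?xs = "map l [1..<Suc CARD('h)]"
  have "proots (charpoly A) = (\<Sum>i=1..CARD('h). {#l i#})"
    unfolding charpoly_eigbasis[OF assms(1)] by (subst proots_prod) auto
  also have "\<dots> = mset ?xs"
    by (simp add: sum_unfold_sum_mset mset_upt atLeastLessThanSuc_atLeastAtMost del: upt_Suc)
  finally have "sorted_list_of_multiset (proots (charpoly A)) = sort ?xs"
    by (simp only: sorted_list_of_multiset_mset)
  also have "\<dots> = rev ?xs"
  proof (rule properties_for_sort)
    show "sorted (rev ?xs)"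
      using assms(1)
      by (auto simp: eigbasis_def sorted_wrt_rev sorted_wrt_map simp del: upt_Suc
          intro!: sorted_wrt_mono_rel[OF _ sorted_upt])
  qed simp
  moreover have "k - 1 < CARD('h)"
    using assms(2) by auto
  ultimately show ?thesis
    using assms(2) by (simp add: eigval_def del: upt_Suc)
qed

section \<open>Residual projections and Ky Fan's principle\<close>

definition coproj :: "real ^ 'n ^ 'h \<Rightarrow> real ^ 'h ^ 'h" where
  "coproj V = mat 1 - V ** transpose V"

lemma inner_mat_1: "A \<bullet> mat 1 = trace (A :: real ^ 'h ^ 'h)"
  by (simp add: inner_vec_def mat_def trace_def if_distrib[of "\<lambda>t. _ * t"] cong: if_cong)

lemma inner_coproj:
  fixes A :: "real ^ 'h ^ 'h" and V :: "real ^ 'n ^ 'h"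
  shows "A \<bullet> coproj V = trace A - (\<Sum>k\<in>UNIV. column k V \<bullet> (A *v column k V))"
proof -
  have "A \<bullet> (V ** transpose V) = (\<Sum>a\<in>UNIV. \<Sum>b\<in>UNIV. \<Sum>k\<in>UNIV. A $ a $ b * (V $ a $ k * V $ b $ k))"
    by (simp add: inner_vec_def matrix_matrix_mult_def transpose_def sum_distrib_left)
  also have "\<dots> = (\<Sum>a\<in>UNIV. \<Sum>k\<in>UNIV. \<Sum>b\<in>UNIV. A $ a $ b * (V $ a $ k * V $ b $ k))"
    by (intro sum.cong refl sum.swap)
  also have "\<dots> = (\<Sum>k\<in>UNIV. \<Sum>a\<in>UNIV. \<Sum>b\<in>UNIV. A $ a $ b * (V $ a $ k * V $ b $ k))"
    by (rule sum.swap)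
  also have "\<dots> = (\<Sum>k\<in>UNIV. column k V \<bullet> (A *v column k V))"
    by (simp add: inner_vec_def matrix_vector_mult_def column_def sum_distrib_left mult_ac)
  finally show ?thesis
    by (simp add: coproj_def inner_diff_right inner_mat_1)
qed

lemma inner_matrix_vector_transpose: "(A *v x) \<bullet> y = x \<bullet> (transpose A *v y)"
  for A :: "real ^ 'n ^ 'm"
  by (metis dot_lmul_matrix vector_transpose_matrix inner_commute transpose_transpose)

context
  fixes V :: "real ^ 'n ^ 'h"
  assumes V: "transpose V ** V = mat 1"
begin

lemma norm_orthonormal_columns: "norm (V *v y) = norm y"
  by (simp add: norm_eq_sqrt_inner inner_matrix_vector_transpose matrix_vector_mul_assoc V
      del: transpose_matrix_vector)

lemma power2_norm_residual:
  "(norm (x - V *v (transpose V *v x)))\<^sup>2 = (norm x)\<^sup>2 - (norm (transpose V *v x))\<^sup>2"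
proof -
  have "x \<bullet> (V *v (transpose V *v x)) = (transpose V *v x) \<bullet> (transpose V *v x)"
    by (metis inner_matrix_vector_transpose inner_commute)
  moreover have "(V *v (transpose V *v x)) \<bullet> (V *v (transpose V *v x)) = (transpose V *v x) \<bullet> (transpose V *v x)"
    using norm_orthonormal_columns[of "transpose V *v x"] by (simp add: norm_eq)
  ultimately show ?thesis
    by (simp only: power2_norm_eq_inner inner_diff inner_commute[of "V *v _" x])
qed

text \<open>The squared residual is linear in the rank-one matrix of \<open>x\<close>, so
  integration over \<open>x\<close> can pass into the correlation matrix.\<close>

lemma power2_norm_residual_inner:
  "(norm (x - V *v (transpose V *v x)))\<^sup>2 = (\<chi> a b. x $ a * x $ b) \<bullet> coproj V"
proof -
  let ?A = "(\<chi> a b. x $ a * x $ b) :: real ^ 'h ^ 'h"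
  have Ax: "?A *v y = (x \<bullet> y) *\<^sub>R x" for y
    by (simp add: vec_eq_iff matrix_vector_mult_def inner_vec_def sum_distrib_right sum_distrib_left mult_ac)
  have "column k V \<bullet> (?A *v column k V) = ((transpose V *v x) $ k)\<^sup>2" for k
  proof -
    have "(transpose V *v x) $ k = x \<bullet> column k V"
      by (simp add: matrix_vector_mult_def transpose_def column_def inner_vec_def mult_ac
        del: transpose_matrix_vector)
    then show ?thesis
      unfolding Ax by (simp add: inner_commute power2_eq_square)
  qed
  moreover have "trace ?A = x \<bullet> x" by (simp add: trace_def inner_vec_def)
  ultimately show ?thesis
    unfolding power2_norm_residual inner_coproj unfolding power2_norm_eq_inner
    by (simp add: inner_vec_def[of "transpose V *v x"] power2_eq_square
       del: transpose_matrix_vector)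
qed

text \<open>Row \<open>a\<close> of \<open>coproj V\<close> is the residual of the unit vector of
  \<open>a\<close>, of norm at most 1. The bound is crude but the same for all \<open>V\<close>, as
  a data-dependent \<open>V\<close> requires.\<close>

lemma norm_coproj_le: "norm (coproj V) \<le> CARD('h)"
proof -
  have "norm (coproj V $ a) \<le> 1" for a
  proof -
    have "coproj V $ a = axis a 1 - V *v (transpose V *v axis a 1)"
      by (simp add: coproj_def vec_eq_iff mat_def axis_def matrix_matrix_mult_def matrix_vector_mult_def
        transpose_def if_distrib[of "\<lambda>t. _ * t"] mult.commute eq_commute cong: if_cong)
    moreover have "(norm (axis a 1 - V *v (transpose V *v axis a 1)))\<^sup>2 \<le> 1"
      by (subst power2_norm_residual) (simp add: norm_axis_1)
    ultimately show ?thesis by (simp add: abs_square_le_1 del: transpose_matrix_vector)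
  qed
  then show ?thesis
    using sum_bounded_above[of UNIV "\<lambda>a. norm (coproj V $ a)" 1]
      L2_set_le_sum[of UNIV "\<lambda>a. norm (coproj V $ a)"]
    by (simp add: norm_vec_def[of "coproj V"])
qed

end

lemma onb_expand:
  fixes w :: "nat \<Rightarrow> real ^ 'h"
  assumes "onb w"
  shows "(\<Sum>i=1..CARD('h). (x \<bullet> w i) *\<^sub>R w i) = x"
proof -
  have "(\<Sum>i=1..CARD('h). (x \<bullet> w i) *\<^sub>R w i) \<bullet> y = x \<bullet> y" for y :: "real ^ 'h"
    using onb_parseval[OF assms, of x y] by (simp add: inner_commute[of _ y] inner_sum_right)
  then show ?thesis using vector_eq_rdot by blast
qed

lemma eigbasis_quadratic_form:
  fixes A :: "real ^ 'h ^ 'h"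
  assumes "eigbasis A w l"
  shows "x \<bullet> (A *v x) = (\<Sum>i=1..CARD('h). l i * (x \<bullet> w i)\<^sup>2)"
proof -
  have "A *v x = A *v (\<Sum>i=1..CARD('h). (x \<bullet> w i) *\<^sub>R w i)"
    using assms by (simp only: onb_expand eigbasis_def)
  also have "\<dots> = (\<Sum>i=1..CARD('h). (x \<bullet> w i) *\<^sub>R (l i *\<^sub>R w i))"
    using assms by (simp add: linear_sum[OF matrix_vector_mul_linear] matrix_vector_mult_scaleR eigbasis_def)
  finally show ?thesis
    by (simp add: inner_sum_right power2_eq_square mult_ac)
qed

lemma eigbasis_trace:
  fixes A :: "real ^ 'h ^ 'h"
  assumes "eigbasis A w l"
  shows "trace A = (\<Sum>i=1..CARD('h). l i)"
  using assms by (subst onb_trace[symmetric, of w]) (auto simp: eigbasis_def onb_def intro!: sum.cong)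

definition eigtail :: "nat \<Rightarrow> real ^ 'h ^ 'h \<Rightarrow> real" where
  "eigtail N A = (\<Sum>k = N + 1..CARD('h). eigval A k)"

text \<open>Measured from the trace, the tail involves only the leading eigenvalues, the form in
  which it can be compared with \<open>inner_coproj\<close>.\<close>

lemma eigtail_eigbasis:
  fixes A :: "real ^ 'h ^ 'h"
  assumes "eigbasis A w l" "N \<le> CARD('h)"
  shows "eigtail N A = trace A - (\<Sum>i=1..N. l i)"
proof -
  have "eigtail N A = (\<Sum>k = N + 1..CARD('h). l k)"
    unfolding eigtail_def by (intro sum.cong refl eigval_eigbasis[OF assms(1)]) auto
  moreover have "(\<Sum>i=1..CARD('h). l i) = (\<Sum>i=1..N. l i) + (\<Sum>k = N + 1..CARD('h). l k)"
    using assms(2) sum.ub_add_nat[of 1 N l "CARD('h) - N"] by simp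
  ultimately show ?thesis by (simp add: eigbasis_trace[OF assms(1)])
qed

text \<open>The case of equality in Ky Fan's principle: every column contributes exactly its
  eigenvalue, and \<open>e\<close> only renumbers them.\<close>

lemma eigtail_eq_coproj:
  fixes A :: "real ^ 'h ^ 'h" and V :: "real ^ 'n ^ 'h"
  assumes "eigbasis A w l" "CARD('n) \<le> CARD('h)"
    and e: "bij_betw e (UNIV :: 'n set) {1..CARD('n)}" and V: "\<And>k. column k V = w (e k)"
  shows "eigtail CARD('n) A = A \<bullet> coproj V"
proof -
  have "e k \<in> {1..CARD('n)}" for k
    using e by (auto simp: bij_betw_def)
  then have "e k \<in> {1..CARD('h)}" for k
    using assms(2) by (force intro: order_trans)
  then have "column k V \<bullet> (A *v column k V) = l (e k)" for k
    using assms(1) by (auto simp: V eigbasis_def onb_def)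
  then show ?thesis
    by (simp only: eigtail_eigbasis[OF assms(1,2)] inner_coproj sum_UNIV_bij[OF e])
qed

lemma orthonormal_columns_of_onb:
  fixes V :: "real ^ 'n ^ 'h"
  assumes "onb w" "CARD('n) \<le> CARD('h)"
    and e: "bij_betw e (UNIV :: 'n set) {1..CARD('n)}" and V: "\<And>k. column k V = w (e k)"
  shows "transpose V ** V = mat 1"
proof -
  have "e k \<in> {1..CARD('n)}" for k
    using e by (auto simp: bij_betw_def)
  then have "e k \<in> {1..CARD('h)}" for k
    using assms(2) by (force intro: order_trans)
  moreover have "e i = e j \<longleftrightarrow> i = j" for i j
    using e by (auto simp: bij_betw_def inj_on_def)
  ultimately show ?thesis
    using assms(1) by (simp add: matrix_mult_transpose_dot_column vec_eq_iff mat_def V onb_def)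
qed

text \<open>\<open>c i\<close> is the squared length of the projection of \<open>w i\<close> onto
  the column space: it lies between 0 and 1, and the sum of all \<open>c i\<close> is
  \<open>N\<close>. Under these constraints a weighted sum of the decreasing \<open>l i\<close> is
  largest when the weight sits on the first \<open>N\<close> indices, that is for
  \<open>d\<close>.\<close>

lemma ky_fan:
  fixes A :: "real ^ 'h ^ 'h" and V :: "real ^ 'n ^ 'h"
  assumes A: "eigbasis A w l" and N: "CARD('n) \<le> CARD('h)" and V: "transpose V ** V = mat 1"
  shows "eigtail CARD('n) A \<le> A \<bullet> coproj V"
proof -
  define N where "N = CARD('n)"
  define c where "c i = (\<Sum>k\<in>UNIV. (column k V \<bullet> w i)\<^sup>2)" for i
  define d :: "nat \<Rightarrow> real" where "d i = (if i \<le> N then 1 else 0)" for i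
  have w: "onb w" using A by (simp add: eigbasis_def)
  have ci: "c i \<le> 1" if "i \<in> {1..CARD('h)}" for i
  proof -
    have "c i = (norm (transpose V *v w i))\<^sup>2"
      unfolding c_def power2_norm_eq_inner inner_vec_def[of "transpose V *v w i"]
      by (simp add: inner_vec_def column_def matrix_vector_mult_def
          transpose_def power2_eq_square mult_ac del: transpose_matrix_vector)
    then have "0 \<le> (norm (w i))\<^sup>2 - c i"
      using power2_norm_residual[OF V, of "w i"] by (metis zero_le_power2)
    moreover have "(norm (w i))\<^sup>2 = 1"
      using that w by (auto simp: onb_def power2_norm_eq_inner)
    ultimately show ?thesis by simp
  qed
  have "column k V \<bullet> column k V = 1" for k
    using arg_cong[OF V, of "\<lambda>M. M $ k $ k"] by (simp add: matrix_mult_transpose_dot_column mat_def)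
  then have "(\<Sum>i=1..CARD('h). (column k V \<bullet> w i)\<^sup>2) = 1" for k
    using onb_parseval[OF w, of "column k V" "column k V"] by (simp add: power2_eq_square)
  then have sc: "(\<Sum>i=1..CARD('h). c i) = N"
    unfolding c_def by (subst sum.swap) (simp add: N_def)
  have l12: "{1..CARD('h)} \<inter> {i. i \<le> N} = {1..N}" using N by (auto simp: N_def)
  have sd: "(\<Sum>i=1..CARD('h). x i * d i) = (\<Sum>i=1..N. x i)" for x
    using l12 by (simp add: d_def if_distrib[of "\<lambda>t. _ * t"] sum.If_cases cong: if_cong)
  have N1: "1 \<le> N" "N \<le> CARD('h)" using N by (auto simp: N_def Suc_leI)
  \<comment> \<open>Subtracting the threshold \<open>l N\<close> does not change the sum, because
    \<open>d\<close> and \<open>c\<close> have the same total. It makes each term nonnegative: both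
    factors are nonnegative up to \<open>N\<close> and nonpositive beyond.\<close>
  have "0 \<le> (\<Sum>i=1..CARD('h). (l i - l N) * (d i - c i))"
  proof (intro sum_nonneg)
    fix i assume i: "i \<in> {1..CARD('h)}"
    have "0 \<le> c i" by (simp add: c_def sum_nonneg)
    moreover have "i \<le> N \<Longrightarrow> l N \<le> l i" "\<not> i \<le> N \<Longrightarrow> l i \<le> l N"
      using A i N1 by (auto simp: eigbasis_def)
    ultimately show "0 \<le> (l i - l N) * (d i - c i)"
      using ci[OF i] by (auto simp: d_def intro: mult_nonneg_nonneg mult_nonpos_nonneg)
  qed
  also have "\<dots> = (\<Sum>i=1..CARD('h). l i * d i) - (\<Sum>i=1..CARD('h). l i * c i)
      - l N * ((\<Sum>i=1..CARD('h). 1 * d i) - (\<Sum>i=1..CARD('h). c i))"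
    by (simp add: algebra_simps sum_subtractf sum.distrib sum_distrib_left)
  also have "\<dots> = (\<Sum>i=1..N. l i) - (\<Sum>i=1..CARD('h). l i * c i)"
    unfolding sd sc by simp
  also have "(\<Sum>i=1..CARD('h). l i * c i) = (\<Sum>k\<in>UNIV. column k V \<bullet> (A *v column k V))"
    unfolding eigbasis_quadratic_form[OF A] c_def sum_distrib_left by (rule sum.swap)
  finally show ?thesis
    using N by (simp add: inner_coproj eigtail_eigbasis[OF A] N_def)
qed

text \<open>Test \<open>A\<close> with the projection that is optimal for \<open>B\<close>: the tail
  of \<open>B\<close> is attained there, and the tail of \<open>A\<close> is at most the value
  there. Eigenvectors of \<open>A\<close> and \<open>B\<close> need not be close.\<close>

lemma eigtail_le:
  fixes A B :: "real ^ 'h ^ 'h"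
  assumes A: "eigbasis A w l" and B: "eigbasis B w' l'" and N: "CARD('n::finite) \<le> CARD('h)"
  shows "eigtail CARD('n) A - eigtail CARD('n) B \<le> CARD('h) * norm (A - B)"
proof -
  obtain e where e: "bij_betw e (UNIV :: 'n set) {1..CARD('n)}" using ex_bij_UNIV_atLeastAtMost by blast
  define V where "V = (\<chi> i k. w' (e k) $ i)"
  have c: "column k V = w' (e k)" for k by (simp add: V_def column_def vec_eq_iff)
  have V: "transpose V ** V = mat 1"
    using orthonormal_columns_of_onb[OF _ N e c] B by (simp add: eigbasis_def)
  have "eigtail CARD('n) A - eigtail CARD('n) B \<le> A \<bullet> coproj V - B \<bullet> coproj V"
    using ky_fan[OF A N V] eigtail_eq_coproj[OF B N e c] by simp
  also have "\<dots> = (A - B) \<bullet> coproj V" by (simp add: inner_diff_left)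
  also have "\<dots> \<le> norm (A - B) * norm (coproj V)"
    by (rule norm_cauchy_schwarz)
  also have "\<dots> \<le> norm (A - B) * CARD('h)"
    by (intro mult_left_mono norm_coproj_le V) auto
  finally show ?thesis by (simp add: mult.commute)
qed

lemma abs_eigtail_diff_le:
  fixes A B :: "real ^ 'h ^ 'h"
  assumes A: "eigbasis A w l" and B: "eigbasis B w' l'" and N: "CARD('n::finite) \<le> CARD('h)"
  shows "\<bar>eigtail CARD('n) A - eigtail CARD('n) B\<bar> \<le> CARD('h) * norm (A - B)"
  using eigtail_le[OF A B N] eigtail_le[OF B A N] by (simp add: norm_minus_commute)

section \<open>The matrix \<open>U U\<^sup>T\<close> and singular value decompositions\<close>

definition gram :: "'c set \<Rightarrow> ('c \<Rightarrow> real ^ 'h) \<Rightarrow> real ^ 'h ^ 'h" where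
  "gram J U = (\<chi> a b. \<Sum>c\<in>J. U c $ a * U c $ b)"

lemma gram_mult_vec: "gram J U *v x = (\<Sum>c\<in>J. (U c \<bullet> x) *\<^sub>R U c)"
proof -
  have "(gram J U *v x) $ a = (\<Sum>c\<in>J. (U c \<bullet> x) *\<^sub>R U c) $ a" for a
    unfolding gram_def matrix_vector_mult_def
    by (simp add: sum_distrib_right inner_vec_def sum_component) 
       (subst sum.swap, simp add: mult_ac)
  then show ?thesis by (simp add: vec_eq_iff)
qed

text \<open>For \<open>U = W S Z\<^sup>T\<close> the orthonormality of the \<open>z i\<close> leaves
  \<open>W S S\<^sup>T W\<^sup>T\<close>. \<open>is_svd\<close> does not constrain \<open>s\<close>
  beyond the smaller dimension; \<open>s'\<close> continues it by zero, which supplies the remaining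
  eigenvalues when there are fewer columns than rows.\<close>

lemma eigbasis_gram:
  fixes U :: "'c \<Rightarrow> real ^ 'h"
  assumes svd: "is_svd J U w s z" and "finite J" and "0 \<le> c"
  defines "s' \<equiv> \<lambda>i. if i \<le> min CARD('h) (card J) then s i else 0"
  shows "eigbasis (c *\<^sub>R gram J U) w (\<lambda>i. c * (s' i)\<^sup>2)"
    and "\<And>i. i \<in> {1..CARD('h)} \<Longrightarrow> 0 \<le> s' i"
    and "\<And>i j. i \<in> {1..CARD('h)} \<Longrightarrow> i \<le> j \<Longrightarrow> s' j \<le> s' i"
proof -
  let ?m = "min CARD('h) (card J)"
  have onb: "onb w" using svd by (simp add: is_svd_def onb_def)
  have z: "(\<Sum>c\<in>J. z i c * z j c) = (if i = j then 1 else 0)" if "i \<in> {1..?m}" "j \<in> {1..?m}" for i j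
    using svd that by (auto simp: is_svd_def)
  have U: "U c = (\<Sum>i = 1..?m. (s i * z i c) *\<^sub>R w i)" if "c \<in> J" for c
    using svd that by (simp add: is_svd_def)
  show s0: "0 \<le> s' i" if "i \<in> {1..CARD('h)}" for i
    using svd that by (auto simp: is_svd_def s'_def)
  show smono: "s' j \<le> s' i" if "i \<in> {1..CARD('h)}" "i \<le> j" for i j
    using svd that by (auto simp: is_svd_def s'_def)
  have Uw: "U c \<bullet> w i = s' i * z i c" if "c \<in> J" "i \<in> {1..CARD('h)}" for c i
  proof -
    have "U c \<bullet> w i = (\<Sum>j = 1..?m. s j * z j c * (w j \<bullet> w i))"
      by (simp add: U[OF that(1)] inner_sum_left)
    also have "\<dots> = (\<Sum>j = 1..?m. if j = i then s i * z i c else 0)"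
      using onb that(2) by (intro sum.cong) (auto simp: onb_def)
    finally show ?thesis using that(2) by (auto simp: s'_def)
  qed
  have eig: "gram J U *v w i = (s' i)\<^sup>2 *\<^sub>R w i" if i: "i \<in> {1..CARD('h)}" for i
  proof (cases "i \<le> ?m")
    case False
    then have "s' i = 0" unfolding s'_def by (rule if_not_P)
    then show ?thesis using i by (simp add: gram_mult_vec Uw)
  next
    case True
    have "gram J U *v w i = (\<Sum>c\<in>J. \<Sum>j = 1..?m. (s' i * s j * (z i c * z j c)) *\<^sub>R w j)"
      unfolding gram_mult_vec
    proof (intro sum.cong refl)
      fix c assume c: "c \<in> J"
      have "(U c \<bullet> w i) *\<^sub>R U c = (s' i * z i c) *\<^sub>R (\<Sum>j = 1..?m. (s j * z j c) *\<^sub>R w j)"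
        by (simp only: Uw[OF c i] flip: U[OF c])
      then show "(U c \<bullet> w i) *\<^sub>R U c = (\<Sum>j = 1..?m. (s' i * s j * (z i c * z j c)) *\<^sub>R w j)"
        by (simp add: scaleR_sum_right mult_ac)
    qed
    also have "\<dots> = (\<Sum>j = 1..?m. (s' i * s j * (\<Sum>c\<in>J. z i c * z j c)) *\<^sub>R w j)"
      by (subst sum.swap) (simp add: scaleR_sum_left sum_distrib_left)
    also have "\<dots> = (\<Sum>j = 1..?m. if j = i then (s' i * s i) *\<^sub>R w i else 0)"
      using True i by (intro sum.cong refl, subst z) auto
    also have "\<dots> = (s' i * s i) *\<^sub>R w i" using True i by simp
    also have "s i = s' i" using True by (simp add: s'_def)
    finally show ?thesis by (simp add: power2_eq_square)
  qed
  show "eigbasis (c *\<^sub>R gram J U) w (\<lambda>i. c * (s' i)\<^sup>2)"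
    unfolding eigbasis_def
    using onb eig smono s0 \<open>0 \<le> c\<close>
    by (auto simp: scaleR_matrix_vector_assoc[symmetric] intro!: mult_left_mono power_mono)
qed

text \<open>A singular value decomposition of a positive semidefinite matrix \<open>A\<close> diagonalises it,
  because \<open>A\<close> is the only positive semidefinite square root of \<open>A ** A\<close>.\<close>

lemma eigbasis_psd:
  fixes A :: "real ^ 'h ^ 'h" and U :: "'c \<Rightarrow> real ^ 'h"
  assumes svd: "is_svd J U w s z" and "finite J" and g: "gram J U = A ** A"
    and sym: "transpose A = A" and psd: "\<And>x. 0 \<le> x \<bullet> (A *v x)"
  obtains l where "eigbasis A w l"
proof -
  define \<sigma> where "\<sigma> = (\<lambda>i. if i \<le> min CARD('h) (card J) then s i else 0)"
  have *: "eigbasis (A ** A) w (\<lambda>i. (\<sigma> i)\<^sup>2)" "\<And>i. i \<in> {1..CARD('h)} \<Longrightarrow> 0 \<le> \<sigma> i"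
      "\<And>i j. i \<in> {1..CARD('h)} \<Longrightarrow> i \<le> j \<Longrightarrow> \<sigma> j \<le> \<sigma> i"
    using eigbasis_gram[OF svd \<open>finite J\<close> zero_le_one] unfolding \<sigma>_def g scaleR_one mult_1_left
    by blast+
  have "A *v w i = \<sigma> i *\<^sub>R w i" if i: "i \<in> {1..CARD('h)}" for i
  proof -
    \<comment> \<open>\<open>y\<close> is the defect in the eigenvalue equation. It satisfies
      \<open>A *v y = - \<sigma> i *\<^sub>R y\<close>, so positivity forces \<open>y = 0\<close>
      unless \<open>\<sigma> i = 0\<close>, and that case follows from symmetry.\<close>
    define y where "y = A *v w i - \<sigma> i *\<^sub>R w i"
    have AA: "A *v (A *v w i) = (\<sigma> i)\<^sup>2 *\<^sub>R w i"
      using *(1) i by (simp add: eigbasis_def matrix_vector_mul_assoc)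
    then have "A *v y = - \<sigma> i *\<^sub>R y"
      by (simp add: y_def matrix_vector_mult_diff_distrib matrix_vector_mult_scaleR algebra_simps power2_eq_square)
    then have "\<sigma> i * (y \<bullet> y) \<le> 0" using psd[of y] by simp
    then have "\<sigma> i = 0 \<or> y \<bullet> y \<le> 0"
      using *(2)[of i] i by (auto simp: mult_le_0_iff)
    then show ?thesis
    proof
      assume "\<sigma> i = 0"
      then have "(A *v w i) \<bullet> (A *v w i) = 0"
        using AA by (simp add: inner_matrix_vector_transpose sym del: transpose_matrix_vector)
      with \<open>\<sigma> i = 0\<close> show ?thesis by simp
    next
      assume "y \<bullet> y \<le> 0"
      then have "y = 0" by (metis antisym inner_eq_zero_iff inner_ge_zero)
      then show ?thesis by (simp add: y_def)
    qed
  qed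
  then have "eigbasis A w \<sigma>"
    using * unfolding eigbasis_def by auto
  then show ?thesis by (rule that)
qed

section \<open>Approximation by neural networks\<close>

text \<open>Scalar networks with one hidden layer of activation \<open>exp\<close>. Coefficients are
  indexed by the frequency \<open>a\<close>, so each frequency occurs once and products have to
  merge equal ones.\<close>

definition exp_sums :: "('a::euclidean_space \<Rightarrow> real) set" where
  "exp_sums = {f. \<exists>A c. finite A \<and> f = (\<lambda>x. \<Sum>a\<in>A. c a * exp (a \<bullet> x))}"

lemma exp_sumsI: "finite A \<Longrightarrow> (\<lambda>x. \<Sum>a\<in>A. c a * exp (a \<bullet> x)) \<in> exp_sums"
  by (auto simp: exp_sums_def)

lemma exp_sum_extend:
  fixes c :: "'a::euclidean_space \<Rightarrow> real"
  assumes "finite B" "A \<subseteq> B"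
  shows "(\<Sum>a\<in>A. c a * exp (a \<bullet> x)) = (\<Sum>a\<in>B. (if a \<in> A then c a else 0) * exp (a \<bullet> x))"
  using assms by (intro sum.mono_neutral_cong_left) auto

text \<open>The conditions of the Stone-Weierstrass theorem. Closure under products is the
  functional equation of \<open>exp\<close>, the reason for this choice of activation.\<close>

lemma function_ring_on_exp_sums:
  assumes "compact S"
  shows "function_ring_on (exp_sums :: ('a::euclidean_space \<Rightarrow> real) set) S"
proof
  show "continuous_on S f" if "f \<in> exp_sums" for f :: "'a \<Rightarrow> real"
    using that by (auto simp: exp_sums_def intro!: continuous_intros)
  show "(\<lambda>_. c) \<in> exp_sums" for c :: real
    using exp_sumsI[of "{0}" "\<lambda>_. c"] by simp
next
  fix f g :: "'a \<Rightarrow> real" assume "f \<in> exp_sums" "g \<in> exp_sums"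
  then obtain A c B d where A: "finite A" and f: "f = (\<lambda>x. \<Sum>a\<in>A. c a * exp (a \<bullet> x))"
    and B: "finite B" and g: "g = (\<lambda>x. \<Sum>a\<in>B. d a * exp (a \<bullet> x))"
    by (auto simp: exp_sums_def)
  have "f x + g x = (\<Sum>a\<in>A \<union> B. ((if a \<in> A then c a else 0) + (if a \<in> B then d a else 0)) * exp (a \<bullet> x))" for x
    unfolding f g distrib_right sum.distrib
    using A B by (intro arg_cong2[where f="(+)"] exp_sum_extend) auto
  then show "(\<lambda>x. f x + g x) \<in> exp_sums"
    using A B by (simp only: exp_sumsI finite_UnI)
  let ?s = "\<lambda>p. fst p + snd p :: 'a"
  \<comment> \<open>Pairs of frequencies with equal sum contribute to one exponential, so the
    coefficients are summed over the fibres of \<open>?s\<close>.\<close>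
  have "f x * g x = (\<Sum>e\<in>?s ` (A \<times> B).
      (\<Sum>p\<in>{p\<in>A \<times> B. ?s p = e}. c (fst p) * d (snd p)) * exp (e \<bullet> x))" for x
  proof -
    have "f x * g x = (\<Sum>p\<in>A \<times> B. c (fst p) * d (snd p) * exp (?s p \<bullet> x))"
      unfolding f g sum_product sum.cartesian_product
      by (intro sum.cong refl) (auto simp: inner_add_left exp_add)
    also have "\<dots> = (\<Sum>e\<in>?s ` (A \<times> B). \<Sum>p\<in>{p\<in>A \<times> B. ?s p = e}. c (fst p) * d (snd p) * exp (?s p \<bullet> x))"
      using A B by (intro sum.image_gen) auto
    also have "\<dots> = (\<Sum>e\<in>?s ` (A \<times> B). (\<Sum>p\<in>{p\<in>A \<times> B. ?s p = e}. c (fst p) * d (snd p)) * exp (e \<bullet> x))"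
      unfolding sum_distrib_right by (intro sum.cong refl) auto
    finally show ?thesis .
  qed
  then show "(\<lambda>x. f x * g x) \<in> exp_sums"
    using A B by (simp only: exp_sumsI finite_imageI finite_cartesian_product)
next
  fix x y :: 'a assume "x \<noteq> y"
  \<comment> \<open>The frequency \<open>x - y\<close> separates \<open>x\<close> from
    \<open>y\<close>: the two exponents differ by the squared distance.\<close>
  then have "(x - y) \<bullet> (x - y) \<noteq> 0" by simp
  then have "exp ((x - y) \<bullet> x) \<noteq> exp ((x - y) \<bullet> y)"
    unfolding exp_inj_iff inner_diff_right by simp
  moreover have "(\<lambda>z. exp ((x - y) \<bullet> z)) \<in> exp_sums"
    using exp_sumsI[of "{x - y}" "\<lambda>_. 1"] by simp
  ultimately show "\<exists>f\<in>exp_sums. f x \<noteq> f y"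
    by (intro bexI[of _ "\<lambda>z. exp ((x - y) \<bullet> z)"])
qed fact

text \<open>One hidden neuron per frequency, numbered by \<open>h\<close>; all components share this
  layer and differ only in the output weights.\<close>

lemma neural_network_exp_sum:
  fixes A :: "'a::euclidean_space set" and c :: "'n::finite \<Rightarrow> 'a \<Rightarrow> real"
  assumes "finite A"
  shows "neural_network (\<lambda>x. \<chi> i. \<Sum>a\<in>A. c i a * exp (a \<bullet> x))"
proof -
  obtain h where h: "bij_betw h {0..<card A} A"
    using ex_bij_betw_nat_finite[OF assms] by blast
  obtain e where e: "bij_betw e (UNIV :: 'n set) {..<CARD('n)}"
    using finite_same_card_bij[of "UNIV :: 'n set" "{..<CARD('n)}"] by auto
  have "ffn_layer (card A) (\<lambda>x i. h i \<bullet> x + 0)"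
    by (rule ffn_layer.input_affine)
  then have "ffn_layer (card A) (\<lambda>x i. exp (h i \<bullet> x + 0))"
    by (rule ffn_layer.activation) (intro continuous_intros)
  then have "ffn_layer CARD('n) (\<lambda>x i. (\<Sum>j<card A. c (inv e i) (h j) * exp (h j \<bullet> x + 0)) + 0)"
    by (rule ffn_layer.affine)
  moreover have "(\<Sum>a\<in>A. c i a * exp (a \<bullet> x)) = (\<Sum>j<card A. c (inv e (e i)) (h j) * exp (h j \<bullet> x))" for i x
    using e sum.reindex_bij_betw[OF h, of "\<lambda>a. c i a * exp (a \<bullet> x)"]
    by (simp add: bij_betw_def lessThan_atLeast0)
  ultimately show ?thesis
    unfolding neural_network_def using e by (intro exI conjI) auto
qed

text \<open>One hidden layer with activation \<open>exp\<close> suffices: the functions it computes form an algebra.\<close>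

lemma neural_network_approx:
  fixes f :: "'a::euclidean_space \<Rightarrow> real ^ 'n"
  assumes "compact S" "continuous_on S f" "0 < \<eta>"
  obtains q where "neural_network q" "\<And>x. x \<in> S \<Longrightarrow> norm (f x - q x) < \<eta>"
proof -
  interpret function_ring_on "exp_sums :: ('a \<Rightarrow> real) set" S
    by (rule function_ring_on_exp_sums) fact
  have "\<exists>g\<in>exp_sums. \<forall>x\<in>S. \<bar>f x $ i - g x\<bar> < \<eta> / CARD('n)" for i
    by (rule Stone_Weierstrass_basic) (use assms in \<open>auto intro!: continuous_intros\<close>)
  then have "\<exists>A c. finite A \<and> (\<forall>x\<in>S. \<bar>f x $ i - (\<Sum>a\<in>A. c a * exp (a \<bullet> x))\<bar> < \<eta> / CARD('n))" for i
    unfolding exp_sums_def by blast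
  then obtain A c where A: "\<And>i. finite (A i)"
    and c: "\<And>i x. x \<in> S \<Longrightarrow> \<bar>f x $ i - (\<Sum>a\<in>A i. c i a * exp (a \<bullet> x))\<bar> < \<eta> / CARD('n)"
    by metis
  \<comment> \<open>Each component comes with its own frequencies, but the network has a single
    hidden layer: the union is used, with coefficient 0 where a frequency is absent.\<close>
  define B where "B = (\<Union>i. A i)"
  have B: "finite B" using A by (simp add: B_def)
  define q where "q = (\<lambda>x. \<chi> i. \<Sum>a\<in>B. (if a \<in> A i then c i a else 0) * exp (a \<bullet> x))"
  have q: "q x $ i = (\<Sum>a\<in>A i. c i a * exp (a \<bullet> x))" for x i
  proof -
    have "A i \<subseteq> B" by (auto simp: B_def)
    then show ?thesis using exp_sum_extend[OF B, of "A i" "c i" x] by (simp add: q_def)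
  qed
  show ?thesis
  proof
    show "neural_network q" unfolding q_def by (rule neural_network_exp_sum[OF B])
    fix x assume x: "x \<in> S"
    have "norm (f x - q x) \<le> (\<Sum>i\<in>UNIV. \<bar>(f x - q x) $ i\<bar>)"
      by (rule norm_le_l1_cart)
    also have "\<dots> < (\<Sum>i\<in>(UNIV :: 'n set). \<eta> / CARD('n))"
      using c[OF x] by (intro sum_strict_mono) (auto simp: q)
    finally show "norm (f x - q x) < \<eta>" by simp
  qed
qed

lemma ffn_layer_continuous: "ffn_layer d f \<Longrightarrow> continuous_on UNIV (\<lambda>x. f x i)"
proof (induction arbitrary: i rule: ffn_layer.induct)
  case (activation d f \<rho>)
  then show ?case
    using continuous_on_compose2[of UNIV \<rho> UNIV "\<lambda>x. f x i"] by auto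
qed (auto intro!: continuous_intros)

text \<open>Secures integrability: the Bochner integrals in \<open>err_R\<close> and
  \<open>err_NN\<close> would take the value 0 on a nonintegrable function.\<close>

lemma neural_network_continuous:
  assumes "neural_network q"
  shows "continuous_on S q"
proof -
  have "continuous_on UNIV (\<lambda>x. q x $ i)" for i
    using assms ffn_layer_continuous by (auto simp: neural_network_def)
  then have "continuous_on UNIV (\<lambda>x. \<chi> i. q x $ i)"
    by (intro continuous_on_vec_lambda)
  then show ?thesis
    using continuous_on_subset by auto
qed

section \<open>Error decomposition\<close>

lemma set_integrable_compact:
  fixes f :: "'a::euclidean_space \<Rightarrow> real"
  assumes "compact S" "continuous_on S f"
  shows "set_integrable lborel S f"
  using borel_integrable_compact[OF assms] by (simp add: set_integrable_def)

lemma set_integral_nonneg: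
  fixes f :: "'a \<Rightarrow> real"
  assumes "\<And>x. x \<in> S \<Longrightarrow> 0 \<le> f x"
  shows "0 \<le> (LINT x:S|M. f x)"
  unfolding set_lebesgue_integral_def
  using assms by (intro Bochner_Integration.integral_nonneg) (auto simp: indicator_def)

text \<open>For positive \<open>a\<close> and \<open>b\<close> the bound is least at
  \<open>t = sqrt b / sqrt a\<close>, where it equals
  \<open>(sqrt a + sqrt b)\<^sup>2\<close>.\<close>

lemma sqrt_le_add_of_weighted:
  fixes a b c :: real
  assumes "0 \<le> a" "0 \<le> b" and *: "\<And>t. 0 < t \<Longrightarrow> c \<le> (1 + t) * a + (1 + 1 / t) * b"
  shows "sqrt c \<le> sqrt a + sqrt b"
proof (rule field_le_epsilon)
  fix e :: real assume e: "0 < e"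
  \<comment> \<open>The margins \<open>e / 2\<close> keep both numbers positive, so that
    \<open>t = y / x\<close> is admissible even if \<open>a\<close> or \<open>b\<close> is
    0.\<close>
  define x y where "x = sqrt a + e / 2" and "y = sqrt b + e / 2"
  have pos: "0 < x" "0 < y" using e assms by (auto simp: x_def y_def intro: add_nonneg_pos)
  have "sqrt a \<le> x" "sqrt b \<le> y" using e by (auto simp: x_def y_def)
  then have ab: "a \<le> x\<^sup>2" "b \<le> y\<^sup>2" using assms sqrt_le_D by blast+
  have "c \<le> (1 + y / x) * a + (1 + 1 / (y / x)) * b"
    using pos by (intro *) auto
  also have "\<dots> \<le> (1 + y / x) * x\<^sup>2 + (1 + 1 / (y / x)) * y\<^sup>2"
    using pos ab by (intro add_mono mult_left_mono) auto
  also have "\<dots> = (x + y)\<^sup>2"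
    using pos by (simp add: field_simps power2_eq_square)
  finally have "sqrt c \<le> x + y"
    using pos by (simp add: real_le_lsqrt)
  then show "sqrt c \<le> sqrt a + sqrt b + e" by (simp add: x_def y_def)
qed

lemma norm_add_power2_weighted:
  fixes x y :: "'a::real_inner"
  assumes "0 < t"
  shows "(norm (x + y))\<^sup>2 \<le> (1 + t) * (norm x)\<^sup>2 + (1 + 1 / t) * (norm y)\<^sup>2"
proof -
  define s where "s = sqrt t"
  have s: "0 < s" "t = s * s" using assms by (auto simp: s_def)
  have "0 \<le> (norm (s *\<^sub>R x - (1 / s) *\<^sub>R y))\<^sup>2" by simp
  also have "\<dots> = t * (x \<bullet> x) - 2 * (x \<bullet> y) + (1 / t) * (y \<bullet> y)"
    using s(1) unfolding power2_norm_eq_inner s(2)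
    by (simp add: inner_diff inner_commute[of y x] field_simps)
  finally show ?thesis
    unfolding power2_norm_eq_inner by (simp add: inner_add inner_commute[of y x] algebra_simps)
qed

text \<open>The triangle inequality in the L2 space of weight \<open>1 / \<phi>\<close>: a pointwise
  Young inequality is integrated for each \<open>t\<close> and only then optimised. Where
  \<open>\<phi>\<close> vanishes all quotients are 0.\<close>

lemma weighted_minkowski:
  fixes f g :: "'a \<Rightarrow> 'b::real_inner" and \<phi> :: "'a \<Rightarrow> real"
  assumes "\<And>x. x \<in> S \<Longrightarrow> 0 \<le> \<phi> x"
    and "set_integrable M S (\<lambda>x. (norm (f x))\<^sup>2 / \<phi> x)" "set_integrable M S (\<lambda>x. (norm (g x))\<^sup>2 / \<phi> x)"
    and "set_integrable M S (\<lambda>x. (norm (f x + g x))\<^sup>2 / \<phi> x)" 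
  shows "sqrt (LINT x:S|M. (norm (f x + g x))\<^sup>2 / \<phi> x)
      \<le> sqrt (LINT x:S|M. (norm (f x))\<^sup>2 / \<phi> x) + sqrt (LINT x:S|M. (norm (g x))\<^sup>2 / \<phi> x)"
proof (rule sqrt_le_add_of_weighted)
  fix t :: real assume t: "0 < t"
  have "(LINT x:S|M. (norm (f x + g x))\<^sup>2 / \<phi> x)
     \<le> (LINT x:S|M. (1 + t) * ((norm (f x))\<^sup>2 / \<phi> x) + (1 + 1 / t) * ((norm (g x))\<^sup>2 / \<phi> x))"
  proof (rule set_integral_mono)
    fix x assume "x \<in> S"
    then show "(norm (f x + g x))\<^sup>2 / \<phi> x
       \<le> (1 + t) * ((norm (f x))\<^sup>2 / \<phi> x) + (1 + 1 / t) * ((norm (g x))\<^sup>2 / \<phi> x)"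
      using divide_right_mono[OF norm_add_power2_weighted[OF t, of "f x" "g x"] assms(1)]
      by (simp add: add_divide_distrib)
  qed (intro set_integral_add set_integrable_mult_right assms)+
  also have "\<dots> = (1 + t) * (LINT x:S|M. (norm (f x))\<^sup>2 / \<phi> x) + (1 + 1 / t) * (LINT x:S|M. (norm (g x))\<^sup>2 / \<phi> x)"
    by (subst set_integral_add) (simp_all only: set_integral_mult_right set_integrable_mult_right assms)
  finally show "(LINT x:S|M. (norm (f x + g x))\<^sup>2 / \<phi> x) \<le> \<dots>" .
qed (use assms in \<open>auto intro!: set_integral_nonneg\<close>)

text \<open>The lower bound on \<open>n\<close> holds only almost everywhere, so the quotient need
  not be continuous or bounded on \<open>S\<close>; integrability comes from the majorant
  \<open>f x / m\<^sup>2\<close>.\<close>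

lemma set_integral_quotient:
  fixes f n :: "'a::euclidean_space \<Rightarrow> real"
  assumes "compact S" "continuous_on S f" "continuous_on S n" "0 < m"
    and m: "AE x in lborel. x \<in> S \<longrightarrow> m \<le> n x" and f: "\<And>x. x \<in> S \<Longrightarrow> 0 \<le> f x"
  shows "set_integrable lborel S (\<lambda>x. f x / (n x)\<^sup>2)"
    and "(LINT x:S|lborel. f x / (n x)\<^sup>2) \<le> (LINT x:S|lborel. f x) / m\<^sup>2"
proof -
  have if_: "set_integrable lborel S f" and in_: "set_integrable lborel S n"
    using assms by (auto intro: set_integrable_compact)
  have meas: "(\<lambda>x. indicator S x *\<^sub>R (f x / (n x)\<^sup>2)) \<in> borel_measurable lborel"
  proof -
    \<comment> \<open>Numerator and denominator are truncated separately, each being measurable; off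
      \<open>S\<close> the quotient is 0 / 0 = 0.\<close>
    have "(\<lambda>x. (indicator S x *\<^sub>R f x) / (indicator S x *\<^sub>R n x)\<^sup>2) \<in> borel_measurable lborel"
      using if_ in_ unfolding set_integrable_def
      by (intro borel_measurable_divide borel_measurable_power) auto
    also have "(\<lambda>x. (indicator S x *\<^sub>R f x) / (indicator S x *\<^sub>R n x)\<^sup>2) = (\<lambda>x. indicator S x *\<^sub>R (f x / (n x)\<^sup>2))"
      by (auto simp: indicator_def)
    finally show ?thesis .
  qed
  have le: "AE x in lborel. indicator S x *\<^sub>R (f x / (n x)\<^sup>2) \<le> indicator S x *\<^sub>R (f x / m\<^sup>2)"
    using m
  proof eventually_elim
    case (elim x)
    then show ?case using \<open>0 < m\<close> f[of x]
      by (auto simp: indicator_def intro!: divide_left_mono power_mono mult_pos_pos)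
  qed
  have im: "set_integrable lborel S (\<lambda>x. f x / m\<^sup>2)"
    using if_ \<open>0 < m\<close> by simp
  show i: "set_integrable lborel S (\<lambda>x. f x / (n x)\<^sup>2)"
    unfolding set_integrable_def
  proof (rule Bochner_Integration.integrable_bound)
    show "integrable lborel (\<lambda>x. indicator S x *\<^sub>R (f x / m\<^sup>2))"
      using im by (simp add: set_integrable_def)
    show "AE x in lborel. norm (indicator S x *\<^sub>R (f x / (n x)\<^sup>2)) \<le> norm (indicator S x *\<^sub>R (f x / m\<^sup>2))"
      using le by eventually_elim (use f in \<open>auto simp: indicator_def\<close>)
  qed (rule meas)
  have "(LINT x:S|lborel. f x / (n x)\<^sup>2) \<le> (LINT x:S|lborel. f x / m\<^sup>2)"
    unfolding set_lebesgue_integral_def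
    using i im le by (intro integral_mono_AE) (auto simp: set_integrable_def)
  then show "(LINT x:S|lborel. f x / (n x)\<^sup>2) \<le> (LINT x:S|lborel. f x) / m\<^sup>2"
    by simp
qed

lemma sol_essinf_bounds:
  fixes u :: "(real ^ 'p) \<times> real \<Rightarrow> real ^ 'h"
  assumes "compact P" "emeasure lborel P > 0" "T > 0" "sol_essinf P T u > 0"
  shows "0 < real_of_ereal (sol_essinf P T u)"
    and "AE x in lborel. x \<in> P \<times> {0..T} \<longrightarrow> real_of_ereal (sol_essinf P T u) \<le> norm (u x)"
proof -
  let ?S = "P \<times> {0..T}"
  have PB: "P \<in> sets borel" using assms(1) by (simp add: compact_imp_closed)
  have S: "?S \<in> sets lborel"
    using assms(1) by (simp add: compact_Times borel_closed compact_imp_closed)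
  have AE: "AE x in lborel. x \<in> ?S \<longrightarrow> sol_essinf P T u \<le> ereal (norm (u x))"
    using esssup_AE[of "\<lambda>x. - ereal (norm (u x))" "restrict_space lborel ?S"] S
    unfolding sol_essinf_def essinf_def
    by (subst (asm) AE_restrict_space_iff) (auto elim!: eventually_mono simp: ereal_uminus_le_reorder)
  \<comment> \<open>\<open>real_of_ereal\<close> sends infinity to 0, so positivity of the real
    number requires excluding this value; it would make the domain a null set.\<close>
  have "sol_essinf P T u \<noteq> \<infinity>"
  proof
    assume "sol_essinf P T u = \<infinity>"
    with AE have "AE x in lborel. x \<notin> ?S" by auto
    then have "emeasure lborel ?S = 0"
      using S by (subst (asm) AE_iff_measurable[of ?S]) auto
    moreover have "emeasure lborel ?S = emeasure lborel P * ennreal T"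
      using PB \<open>T > 0\<close> unfolding lborel_prod[symmetric]
      by (subst lborel.emeasure_pair_measure_Times) auto
    ultimately show False using assms by (auto simp: ennreal_eq_0_iff)
  qed
  with assms(4) have e: "sol_essinf P T u = ereal (real_of_ereal (sol_essinf P T u))"
    by (cases "sol_essinf P T u") auto
  show "0 < real_of_ereal (sol_essinf P T u)"
    using assms(4) e by (metis ereal_less(2))
  show "AE x in lborel. x \<in> ?S \<longrightarrow> real_of_ereal (sol_essinf P T u) \<le> norm (u x)"
    using AE by eventually_elim (metis e ereal_less_eq(3))
qed

section \<open>Spectral identities for POD matrices\<close>

lemma eigtail_nonneg:
  fixes A :: "real ^ 'h ^ 'h"
  assumes "eigbasis A w l" "\<And>i. i \<in> {1..CARD('h)} \<Longrightarrow> 0 \<le> l i"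
  shows "0 \<le> eigtail N A"
  unfolding eigtail_def
  by (intro sum_nonneg) (use assms eigval_eigbasis[OF assms(1)] in auto)

text \<open>All that is used of a POD matrix. It holds for every singular value decomposition, so
  the ambiguity of \<open>V\<close> at repeated singular values is harmless; \<open>c\<close> stands
  for the normalisation of the correlation matrix.\<close>

lemma pod_matrix:
  fixes U :: "'c \<Rightarrow> real ^ 'h" and V :: "real ^ 'n ^ 'h"
  assumes "is_pod_matrix J U V" "finite J" "0 \<le> c" and N: "CARD('n) \<le> CARD('h)"
  shows "\<exists>w l. eigbasis (c *\<^sub>R gram J U) w l"
    and "eigtail CARD('n) (c *\<^sub>R gram J U) = (c *\<^sub>R gram J U) \<bullet> coproj V"
    and "transpose V ** V = mat 1"
    and "0 \<le> eigtail CARD('n) (c *\<^sub>R gram J U)"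
proof -
  obtain w s z e where svd: "is_svd J U w s z" and e: "bij_betw e (UNIV :: 'n set) {1..CARD('n)}"
    and V: "\<And>k. column k V = w (e k)"
    using assms(1) unfolding is_pod_matrix_def by blast
  note eig = eigbasis_gram[OF svd assms(2,3)]
  from eig(1) show "\<exists>w l. eigbasis (c *\<^sub>R gram J U) w l" by blast
  show "eigtail CARD('n) (c *\<^sub>R gram J U) = (c *\<^sub>R gram J U) \<bullet> coproj V"
    by (rule eigtail_eq_coproj[OF eig(1) N e V])
  show "transpose V ** V = mat 1"
    using orthonormal_columns_of_onb[OF _ N e V] eig(1) by (simp add: eigbasis_def)
  show "0 \<le> eigtail CARD('n) (c *\<^sub>R gram J U)"
    by (rule eigtail_nonneg[OF eig(1)]) (use \<open>0 \<le> c\<close> in auto)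
qed

lemma compact_domain: "compact P \<Longrightarrow> compact (P \<times> {0..T::real})"
  by (intro compact_Times) auto

lemma corr_matrix_eq_gram:
  "corr_matrix P T u Ns Nt \<theta> = (measure lborel (P \<times> {0..T}) / real (Ns * Nt)) *\<^sub>R
     gram ({1..Ns} \<times> {1..Nt}) (snapshots T u Ns Nt \<theta>)"
  by (simp add: corr_matrix_def gram_def)

lemma corr_matrix_inf_symmetric: "transpose (corr_matrix_inf P T u) = corr_matrix_inf P T u"
  by (simp add: corr_matrix_inf_def transpose_def vec_eq_iff mult.commute)

section \<open>The error terms for a fixed sample\<close>

context
  fixes P :: "(real ^ 'p) set" and T :: real and u :: "(real ^ 'p) \<times> real \<Rightarrow> real ^ 'h"
  assumes P: "compact P" and Ppos: "emeasure lborel P > 0" and T: "T > 0"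
    and essinf: "sol_essinf P T u > 0" and cont: "continuous_on (P \<times> {0..T}) u"
begin

lemma corr_matrix_inf_inner:
  "(LINT x:P \<times> {0..T}|lborel. (\<chi> a b. u x $ a * u x $ b) \<bullet> B) = corr_matrix_inf P T u \<bullet> B"
proof -
  have i: "set_integrable lborel (P \<times> {0..T}) (\<lambda>x. u x $ a * u x $ b)" for a b
    by (intro set_integrable_compact compact_domain P continuous_intros cont)
  then have iB: "integrable lborel (\<lambda>x. indicator (P \<times> {0..T}) x *\<^sub>R (u x $ a * u x $ b * B $ a $ b))" for a b
    by (unfold set_integrable_def[symmetric]) (intro set_integrable_mult_left i)
  have "(LINT x:P \<times> {0..T}|lborel. (\<chi> a b. u x $ a * u x $ b) \<bullet> B)
      = (\<Sum>a\<in>UNIV. \<Sum>b\<in>UNIV. LINT x:P \<times> {0..T}|lborel. u x $ a * u x $ b * B $ a $ b)"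
    unfolding set_lebesgue_integral_def inner_vec_def scaleR_sum_right
    by (simp only: vec_lambda_beta inner_real_def scaleR_sum_right
         Bochner_Integration.integral_sum Bochner_Integration.integrable_sum iB)
  then show ?thesis
    by (simp add: corr_matrix_inf_def inner_vec_def)
qed

text \<open>The quadratic form is the integral of \<open>(u x \<bullet> y)\<^sup>2\<close>.
  Positivity is what lets a singular value decomposition yield an eigenbasis of this matrix.\<close>

lemma corr_matrix_inf_psd: "0 \<le> y \<bullet> (corr_matrix_inf P T u *v y)"
proof -
  have "y \<bullet> (corr_matrix_inf P T u *v y) = corr_matrix_inf P T u \<bullet> (\<chi> a b. y $ a * y $ b)"
    by (simp add: inner_vec_def matrix_vector_mult_def sum_distrib_left mult_ac)
  also have "\<dots> = (LINT x:P \<times> {0..T}|lborel. (u x \<bullet> y)\<^sup>2)"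
    by (subst corr_matrix_inf_inner[symmetric])
       (simp add: inner_vec_def power2_eq_square sum_product mult_ac)
  finally show ?thesis by (simp add: set_integral_nonneg)
qed

lemma integral_residual:
  assumes "transpose V ** V = mat 1"
  shows "(LINT x:P \<times> {0..T}|lborel. (norm (u x - V *v (transpose V *v u x)))\<^sup>2)
    = corr_matrix_inf P T u \<bullet> coproj V"
  unfolding power2_norm_residual_inner[OF assms] by (rule corr_matrix_inf_inner)

lemma err_R_le:
  fixes V :: "real ^ 'n ^ 'h"
  assumes V: "transpose V ** V = mat 1" and tail: "0 \<le> eigtail CARD('n) (corr_matrix P T u Ns Nt \<theta>)"
    and q: "neural_network q"
  shows "err_R P T u V q \<le> err_S P T u V Ns Nt \<theta> + err_POD P T u CARD('n) Ns Nt \<theta> + err_NN P T u V q"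
proof -
  let ?S = "P \<times> {0..T}"
  define m where "m = real_of_ereal (sol_essinf P T u)"
  note m = sol_essinf_bounds[OF P Ppos T essinf, folded m_def]
  \<comment> \<open>\<open>f\<close> is the projection residual and \<open>g\<close> the network
    error inside the reduced space; they add up to \<open>u x - V *v q x\<close>.\<close>
  define f where "f x = u x - V *v (transpose V *v u x)" for x
  define g where "g x = V *v (transpose V *v u x) - V *v q x" for x
  have cf: "continuous_on ?S f" and cg: "continuous_on ?S g"
    unfolding f_def g_def
    by (intro continuous_intros cont matrix_vector_mult_linear_continuous_on
        neural_network_continuous q
        linear_continuous_on_compose[OF _ matrix_vector_mul_linear])+
  have i: "set_integrable lborel ?S (\<lambda>x. (norm (h x))\<^sup>2 / (norm (u x))\<^sup>2)"
    and le: "(LINT x:?S|lborel. (norm (h x))\<^sup>2 / (norm (u x))\<^sup>2) \<le> (LINT x:?S|lborel. (norm (h x))\<^sup>2) / m\<^sup>2"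
    if "continuous_on ?S h" for h :: "(real ^ 'p) \<times> real \<Rightarrow> real ^ 'h"
    by (intro set_integral_quotient[OF compact_domain[OF P] _ _ m] continuous_intros cont that zero_le_power2)+
  have "err_R P T u V q = sqrt (LINT x:?S|lborel. (norm (f x + g x))\<^sup>2 / (norm (u x))\<^sup>2)"
    by (simp add: err_R_def f_def g_def)
  also have "\<dots> \<le> sqrt (LINT x:?S|lborel. (norm (f x))\<^sup>2 / (norm (u x))\<^sup>2)
      + sqrt (LINT x:?S|lborel. (norm (g x))\<^sup>2 / (norm (u x))\<^sup>2)"
    by (intro weighted_minkowski i cf cg continuous_intros) auto
  also have "sqrt (LINT x:?S|lborel. (norm (g x))\<^sup>2 / (norm (u x))\<^sup>2) = err_NN P T u V q"
    by (simp add: err_NN_def g_def)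
  also have "sqrt (LINT x:?S|lborel. (norm (f x))\<^sup>2 / (norm (u x))\<^sup>2)
      \<le> sqrt ((LINT x:?S|lborel. (norm (f x))\<^sup>2) / m\<^sup>2)"
    by (intro real_sqrt_le_mono le cf)
  also have "\<dots> = inverse m * sqrt (LINT x:?S|lborel. (norm (f x))\<^sup>2)"
    using m(1) by (simp add: real_sqrt_divide field_simps)
  \<comment> \<open>With \<open>a\<close> the integral and \<open>b \<ge> 0\<close> the tail,
    \<open>a \<le> \<bar>a - b\<bar> + b\<close>, and the square root is subadditive.\<close>
  also have "\<dots> \<le> inverse m * (sqrt \<bar>(LINT x:?S|lborel. (norm (f x))\<^sup>2) - eigtail CARD('n) (corr_matrix P T u Ns Nt \<theta>)\<bar>
      + sqrt (eigtail CARD('n) (corr_matrix P T u Ns Nt \<theta>)))"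
    using m(1) tail
    by (intro mult_left_mono order_trans[OF _ sqrt_add_le_add_sqrt]) auto
  also have "\<dots> = err_S P T u V Ns Nt \<theta> + err_POD P T u CARD('n) Ns Nt \<theta>"
    by (simp add: err_S_def err_POD_def eigtail_def m_def f_def distrib_left)
  finally show ?thesis by simp
qed

text \<open>\<open>V\<close> is an isometry, so it suffices to approximate the continuous reduced
  coefficients \<open>transpose V *v u x\<close> uniformly on the compact domain.\<close>

lemma err_NN_small:
  fixes V :: "real ^ 'n ^ 'h"
  assumes V: "transpose V ** V = mat 1" and \<eta>: "\<eta> > 0"
  shows "\<exists>q. neural_network q \<and> err_NN P T u V q < \<eta>"
proof -
  let ?S = "P \<times> {0..T}"
  define m where "m = real_of_ereal (sol_essinf P T u)"
  note m = sol_essinf_bounds[OF P Ppos T essinf, folded m_def]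
  define c where "c = measure lborel ?S"
  have c: "0 \<le> c" by (simp add: c_def)
  \<comment> \<open>Chosen so that the quantity under the root becomes
    \<open>\<eta>\<^sup>2 * (c / (c + 1))\<close>; the summand 1 makes the final inequality
    strict.\<close>
  define \<delta> where "\<delta> = \<eta> * m / sqrt (c + 1)"
  have \<delta>: "0 < \<delta>" using m(1) \<eta> c by (simp add: \<delta>_def)
  have "continuous_on ?S (\<lambda>x. transpose V *v u x)"
    by (intro linear_continuous_on_compose[OF _ matrix_vector_mul_linear] cont)
  then obtain q where q: "neural_network q" and approx: "\<And>x. x \<in> ?S \<Longrightarrow> norm (transpose V *v u x - q x) < \<delta>"
    using neural_network_approx[OF compact_domain[OF P] _ \<delta>] by blast
  define g where "g x = V *v (transpose V *v u x) - V *v q x" for x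
  have cg: "continuous_on ?S g"
    unfolding g_def
    by (intro continuous_intros cont neural_network_continuous q
        linear_continuous_on_compose[OF _ matrix_vector_mul_linear])
  have "g x = V *v (transpose V *v u x - q x)" for x
    by (simp only: g_def matrix_vector_mult_diff_distrib)
  then have gle: "(norm (g x))\<^sup>2 \<le> \<delta>\<^sup>2" if "x \<in> ?S" for x
    using approx[OF that] by (simp add: norm_orthonormal_columns[OF V] power_mono)
  have "(LINT x:?S|lborel. (norm (g x))\<^sup>2 / (norm (u x))\<^sup>2) \<le> (LINT x:?S|lborel. (norm (g x))\<^sup>2) / m\<^sup>2"
    by (intro set_integral_quotient[OF compact_domain[OF P] _ _ m] continuous_intros cont cg zero_le_power2)
  also have "(LINT x:?S|lborel. (norm (g x))\<^sup>2) \<le> (LINT x:?S|lborel. \<delta>\<^sup>2)"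
    using gle cg by (intro set_integral_mono set_integrable_compact compact_domain P continuous_intros) auto
  also have "\<dots> = c * \<delta>\<^sup>2"
    by (simp add: c_def set_lebesgue_integral_def)
  finally have "err_NN P T u V q \<le> sqrt (c * \<delta>\<^sup>2 / m\<^sup>2)"
    using m(1) by (simp add: err_NN_def g_def divide_right_mono)
  also have "c * \<delta>\<^sup>2 / m\<^sup>2 = \<eta>\<^sup>2 * (c / (c + 1))"
    using m(1) c by (simp add: \<delta>_def power_divide power_mult_distrib)
  also have "\<dots> < \<eta>\<^sup>2 * 1"
    using c \<eta> by (intro mult_strict_left_mono) auto
  finally show ?thesis using q \<eta> by auto
qed

end

section \<open>Means of bounded independent variables\<close>

context prob_space
begin

lemma integrable_bounded:
  fixes X :: "'a \<Rightarrow> real"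
  assumes "X \<in> borel_measurable M" "\<And>\<omega>. \<omega> \<in> space M \<Longrightarrow> \<bar>X \<omega>\<bar> \<le> B"
  shows "integrable M X"
  by (rule integrable_const_bound[of _ B]) (use assms in auto)

lemma expectation_power2_le:
  fixes X :: "'a \<Rightarrow> real"
  assumes "X \<in> borel_measurable M" "\<And>\<omega>. \<omega> \<in> space M \<Longrightarrow> \<bar>X \<omega>\<bar> \<le> B"
  shows "(expectation X)\<^sup>2 \<le> expectation (\<lambda>\<omega>. (X \<omega>)\<^sup>2)"
proof -
  have "\<bar>(X \<omega>)\<^sup>2\<bar> \<le> B\<^sup>2" if "\<omega> \<in> space M" for \<omega>
    using power_mono[OF assms(2)[OF that], of 2] by simp
  then have "variance X = expectation (\<lambda>\<omega>. (X \<omega>)\<^sup>2) - (expectation X)\<^sup>2"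
    using assms by (intro variance_eq integrable_bounded[of _ B] integrable_bounded[of _ "B\<^sup>2"]) auto
  then show ?thesis using variance_positive[of X] by simp
qed

text \<open>Jensen's inequality for the square root, obtained from the nonnegativity of the variance
  of \<open>sqrt (X \<omega>)\<close>.\<close>

lemma expectation_sqrt_le:
  fixes X :: "'a \<Rightarrow> real"
  assumes [measurable]: "X \<in> borel_measurable M" and B: "\<And>\<omega>. \<omega> \<in> space M \<Longrightarrow> X \<omega> \<le> B"
    and nonneg: "\<And>\<omega>. \<omega> \<in> space M \<Longrightarrow> 0 \<le> X \<omega>"
  shows "expectation (\<lambda>\<omega>. sqrt (X \<omega>)) \<le> sqrt (expectation X)"
proof -
  have "(expectation (\<lambda>\<omega>. sqrt (X \<omega>)))\<^sup>2 \<le> expectation (\<lambda>\<omega>. (sqrt (X \<omega>))\<^sup>2)"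
    using nonneg B by (intro expectation_power2_le[of _ "sqrt B"]) auto
  also have "\<dots> = expectation X"
    using nonneg by (intro Bochner_Integration.integral_cong) auto
  finally show ?thesis by (rule real_le_rsqrt)
qed

context
  fixes X :: "nat \<Rightarrow> 'a \<Rightarrow> real" and B e :: real
  assumes indep: "indep_vars (\<lambda>_. borel) X {1..}"
    and bound: "\<And>j \<omega>. 1 \<le> j \<Longrightarrow> \<omega> \<in> space M \<Longrightarrow> \<bar>X j \<omega>\<bar> \<le> B"
    and mean: "\<And>j. 1 \<le> j \<Longrightarrow> expectation (X j) = e"
begin

lemma random_variable_X: "1 \<le> j \<Longrightarrow> X j \<in> borel_measurable M"
  using indep by (simp add: indep_vars_def)

text \<open>The first absolute moment is controlled by the second. Independence kills the mixed
  products of the centred variables, so only \<open>n\<close> diagonal terms remain, each at most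
  \<open>(2 * B)\<^sup>2\<close>.\<close>

lemma expectation_abs_mean_deviation:
  assumes n: "1 \<le> n"
  shows "expectation (\<lambda>\<omega>. \<bar>(\<Sum>j=1..n. X j \<omega>) / real n - e\<bar>) \<le> 2 * B / sqrt (real n)"
proof -
  define Z where "Z j \<omega> = X j \<omega> - e" for j \<omega>
  have rvX[measurable]: "1 \<le> j \<Longrightarrow> X j \<in> borel_measurable M" for j by (rule random_variable_X)
  have B0: "0 \<le> B" using bound[of 1] not_empty by force
  have e: "\<bar>e\<bar> \<le> B"
  proof -
    have i: "integrable M (X 1)" using bound by (intro integrable_bounded[of _ B]) auto
    have "\<bar>expectation (X 1)\<bar> \<le> expectation (\<lambda>\<omega>. \<bar>X 1 \<omega>\<bar>)"
      by (rule integral_abs_bound)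
    also have "\<dots> \<le> expectation (\<lambda>_. B)"
      using i bound by (intro integral_mono) auto
    finally show ?thesis by (simp add: mean prob_space)
  qed
  have rvZ[measurable]: "1 \<le> j \<Longrightarrow> Z j \<in> borel_measurable M" for j
    unfolding Z_def by measurable
  have Zb: "\<bar>Z j \<omega>\<bar> \<le> 2 * B" if "1 \<le> j" "\<omega> \<in> space M" for j \<omega>
    using bound[OF that] e by (simp add: Z_def)
  have Zi: "integrable M (Z j)" if "1 \<le> j" for j
    using Zb rvZ that by (intro integrable_bounded[of _ "2 * B"]) auto
  have ZZb: "\<bar>Z i \<omega> * Z j \<omega>\<bar> \<le> (2 * B) * (2 * B)" if "1 \<le> i" "1 \<le> j" "\<omega> \<in> space M" for i j \<omega>
    unfolding abs_mult using that B0 by (intro mult_mono Zb) auto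
  have ZZi: "integrable M (\<lambda>\<omega>. Z i \<omega> * Z j \<omega>)" if "1 \<le> i" "1 \<le> j" for i j
    using ZZb that rvZ by (intro integrable_bounded[of _ "(2 * B) * (2 * B)"]) auto
  have Z0: "expectation (Z j) = 0" if "1 \<le> j" for j
    using that bound mean unfolding Z_def
    by (subst Bochner_Integration.integral_diff) (auto intro!: integrable_bounded[of _ B] simp: prob_space)
  have indepZ: "indep_vars (\<lambda>_. borel) Z {1..}"
    unfolding Z_def[abs_def] by (rule indep_vars_compose2[OF indep]) auto
  have ZZ: "expectation (\<lambda>\<omega>. Z i \<omega> * Z j \<omega>) \<le> (if i = j then 4 * B\<^sup>2 else 0)" if "1 \<le> i" "1 \<le> j" for i j
  proof (cases "i = j")
    case True
    have "expectation (\<lambda>\<omega>. Z i \<omega> * Z j \<omega>) \<le> expectation (\<lambda>_. (2 * B) * (2 * B))"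
      using ZZi ZZb that by (intro integral_mono) (auto intro: order_trans[OF abs_ge_self])
    with True show ?thesis by (simp add: prob_space power2_eq_square)
  next
    case False
    have "indep_vars (\<lambda>_. borel) Z {i, j}"
      by (rule indep_vars_subset[OF indepZ]) (use that in auto)
    from indep_vars_lebesgue_integral[OF _ this] have "expectation (\<lambda>\<omega>. \<Prod>k\<in>{i, j}. Z k \<omega>) = (\<Prod>k\<in>{i, j}. expectation (Z k))"
      using Zi that by auto
    with False that show ?thesis by (simp add: Z0)
  qed
  define Y where "Y \<omega> = (\<Sum>j=1..n. Z j \<omega>) / real n" for \<omega>
  have Y: "Y \<omega> = (\<Sum>j=1..n. X j \<omega>) / real n - e" for \<omega>
    using n by (simp add: Y_def Z_def sum_subtractf field_simps)
  have Yb: "\<bar>Y \<omega>\<bar> \<le> 2 * B" if "\<omega> \<in> space M" for \<omega>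
  proof -
    have "\<bar>\<Sum>j=1..n. Z j \<omega>\<bar> \<le> (\<Sum>j=1..n. 2 * B)"
      using Zb that by (intro order_trans[OF sum_abs] sum_mono) auto
    then show ?thesis using n by (simp add: Y_def field_simps)
  qed
  have [measurable]: "Y \<in> borel_measurable M" unfolding Y_def by measurable
  have "(expectation (\<lambda>\<omega>. \<bar>Y \<omega>\<bar>))\<^sup>2 \<le> expectation (\<lambda>\<omega>. \<bar>Y \<omega>\<bar>\<^sup>2)"
    using Yb by (intro expectation_power2_le[of _ "2 * B"]) auto
  also have "\<dots> = expectation (\<lambda>\<omega>. (\<Sum>i=1..n. \<Sum>j=1..n. Z i \<omega> * Z j \<omega>) / (real n)\<^sup>2)"
    by (simp add: Y_def power_divide power2_eq_square sum_product)
  also have "\<dots> = (\<Sum>i=1..n. \<Sum>j=1..n. expectation (\<lambda>\<omega>. Z i \<omega> * Z j \<omega>)) / (real n)\<^sup>2"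
    using ZZi by (subst Bochner_Integration.integral_divide_zero, intro arg_cong2[where f="(/)"] refl,
        subst Bochner_Integration.integral_sum) (auto intro!: sum.cong Bochner_Integration.integral_sum)
  also have "\<dots> \<le> (\<Sum>i=1..n. \<Sum>j=1..n. if i = j then 4 * B\<^sup>2 else 0) / (real n)\<^sup>2"
    by (intro divide_right_mono sum_mono ZZ) auto
  also have "\<dots> = (2 * B / sqrt (real n))\<^sup>2"
    using n by (simp add: power_divide power_mult_distrib power2_eq_square field_simps)
  finally show ?thesis
    unfolding Y by (rule power2_le_imp_le) (use B0 in auto)
qed

lemma strong_law_bounded: "AE \<omega> in M. (\<lambda>n. (\<Sum>j=1..n. X j \<omega>) / real n) \<longlonglongrightarrow> e"
proof -
  have [measurable]: "1 \<le> j \<Longrightarrow> X j \<in> borel_measurable M" for j by (rule random_variable_X)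
  \<comment> \<open>\<open>B\<close> may be 0; a positive \<open>C\<close> keeps the denominator in
    Hoeffding's exponent from vanishing.\<close>
  define C where "C = \<bar>B\<bar> + 1"
  have C: "0 < C" "B \<le> C" by (auto simp: C_def)
  define S where "S n \<omega> = (\<Sum>j=1..n. X j \<omega>)" for n \<omega>
  have [measurable]: "S n \<in> borel_measurable M" for n unfolding S_def by measurable
  have bc: "AE \<omega> in M. eventually (\<lambda>n. \<omega> \<in> space M - {\<omega>\<in>space M. \<bar>S n \<omega> - real n * e\<bar> \<ge> real n * \<delta>}) sequentially"
    if \<delta>: "0 < \<delta>" for \<delta> :: real
  proof (rule borel_cantelli_AE1)
    let ?r = "exp (- (\<delta>\<^sup>2 / (2 * C\<^sup>2)))"
    have pb: "prob {\<omega>\<in>space M. \<bar>S n \<omega> - real n * e\<bar> \<ge> real n * \<delta>} \<le> 2 * ?r ^ n" if n: "1 \<le> n" for n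
    proof -
      interpret H: Hoeffding_ineq M "{1..n}" X "\<lambda>_. - C" "\<lambda>_. C" "\<Sum>j=1..n. expectation (X j)"
      proof unfold_locales
        show "indep_vars (\<lambda>_. borel) X {1..n}"
          by (rule indep_vars_subset[OF indep]) auto
        show "AE x in M. X i x \<in> {- C..C}" if "i \<in> {1..n}" for i
          using bound[of i] C that by (intro AE_I2) (force simp: abs_le_iff)
      qed auto
      have "prob {\<omega>\<in>space M. \<bar>(\<Sum>j=1..n. X j \<omega>) - (\<Sum>j=1..n. expectation (X j))\<bar> \<ge> real n * \<delta>}
        \<le> 2 * exp (- 2 * (real n * \<delta>)\<^sup>2 / (\<Sum>j=1..n. (C - - C)\<^sup>2))"
        using C n \<delta> by (intro H.Hoeffding_ineq_abs_ge) auto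
      also have "(\<Sum>j=1..n. expectation (X j)) = real n * e"
        using mean by simp
      also have "- 2 * (real n * \<delta>)\<^sup>2 / (\<Sum>j=1..n. (C - - C)\<^sup>2) = real n * (- (\<delta>\<^sup>2 / (2 * C\<^sup>2)))"
        using C n by (simp add: power2_eq_square field_simps)
      finally show ?thesis by (simp only: exp_of_nat_mult S_def)
    qed
    have "\<forall>\<^sub>F n in sequentially. norm (prob {\<omega>\<in>space M. \<bar>S n \<omega> - real n * e\<bar> \<ge> real n * \<delta>}) \<le> 2 * ?r ^ n"
      using eventually_ge_at_top[of 1]
    proof eventually_elim
      case (elim n)
      show ?case using pb[OF elim] by (simp only: real_norm_def abs_of_nonneg measure_nonneg)
    qed
    moreover have "summable (\<lambda>n. 2 * ?r ^ n)"
      using \<delta> C by (intro summable_mult summable_geometric) auto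
    ultimately show "summable (\<lambda>n. prob {\<omega>\<in>space M. \<bar>S n \<omega> - real n * e\<bar> \<ge> real n * \<delta>})"
      by (rule summable_comparison_test_ev)
  qed (auto simp: less_top[symmetric])
  \<comment> \<open>Tolerances \<open>1 / real (Suc k)\<close> suffice for convergence, and
    countably many null sets can be discarded together.\<close>
  have "AE \<omega> in M. \<forall>k. eventually (\<lambda>n. \<bar>S n \<omega> - real n * e\<bar> < real n * (1 / real (Suc k))) sequentially"
    unfolding AE_all_countable
  proof
    fix k
    have "0 < 1 / real (Suc k)" by simp
    from bc[OF this] show "AE \<omega> in M. eventually (\<lambda>n. \<bar>S n \<omega> - real n * e\<bar> < real n * (1 / real (Suc k))) sequentially"
      by (rule eventually_mono) (auto elim: eventually_mono)
  qed
  then show ?thesis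
  proof eventually_elim
    case (elim \<omega>)
    show ?case
    proof (rule tendstoI)
      fix r :: real assume "0 < r"
      then obtain k where k: "1 / real (Suc k) < r" using nat_approx_posE by blast
      show "\<forall>\<^sub>F n in sequentially. dist ((\<Sum>j=1..n. X j \<omega>) / real n) e < r"
        using elim[rule_format, of k] eventually_gt_at_top[of 0]
      proof eventually_elim
        case (elim n)
        have "dist ((\<Sum>j=1..n. X j \<omega>) / real n) e = \<bar>S n \<omega> - real n * e\<bar> / real n"
          using elim by (simp add: dist_real_def S_def field_simps abs_divide[symmetric])
        also have "\<dots> < 1 / real (Suc k)"
          using elim by (simp add: field_simps)
        finally show ?case using k by simp
      qed
    qed
  qed
qed

end

end

section \<open>Sampling error of the correlation matrix\<close>

text \<open>Right endpoint rule: on a cell of length \<open>d\<close> the integrand varies by at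
  most \<open>B * d\<close>, an error of at most \<open>B * d\<^sup>2\<close>, and there are
  \<open>n\<close> cells.\<close>

lemma riemann_sum_error:
  fixes h :: "real \<Rightarrow> real"
  assumes lip: "B-lipschitz_on {0..T} h" and T: "0 < T" and n: "1 \<le> n"
  shows "\<bar>T / real n * (\<Sum>k=1..n. h (real k * (T / real n))) - integral {0..T} h\<bar> \<le> B * T\<^sup>2 / real n"
proof -
  define d where "d = T / real n"
  have d: "0 < d" "real n * d = T" using T n by (auto simp: d_def)
  have B: "0 \<le> B" using lip by (rule lipschitz_on_nonneg)
  have cont: "continuous_on {0..T} h" using lip by (rule lipschitz_on_continuous_on)
  have sub: "real j * d \<le> T" if "j \<le> n" for j
    using that d by (metis mult_right_mono of_nat_le_iff less_imp_le)
  have "\<bar>d * (\<Sum>k=1..j. h (real k * d)) - integral {0..real j * d} h\<bar> \<le> real j * (B * d\<^sup>2)" if "j \<le> n" for j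
    using that
  proof (induction j)
    case (Suc j)
    define a b where "a = real j * d" and "b = real (Suc j) * d"
    have ab: "0 \<le> a" "a \<le> b" "b \<le> T" "b - a = d"
      using d sub[OF Suc.prems] by (auto simp: a_def b_def algebra_simps)
    have ca: "continuous_on {a..b} h"
      by (rule continuous_on_subset[OF cont]) (use ab in auto)
    have "integral {0..a} h + integral {a..b} h = integral {0..b} h"
      using ab by (intro Henstock_Kurzweil_Integration.integral_combine
          integrable_continuous_interval continuous_on_subset[OF cont]) auto
    moreover have "\<bar>d * h b - integral {a..b} h\<bar> \<le> B * d\<^sup>2"
    proof -
      have "d * h b - integral {a..b} h = integral {a..b} (\<lambda>t. h b - h t)"
        using ab ca by (subst Henstock_Kurzweil_Integration.integral_diff)
          (auto intro: integrable_continuous_interval)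
      also have "norm \<dots> \<le> B * d * (b - a)"
      proof (rule integral_bound)
        fix t assume t: "t \<in> {a..b}"
        have "norm (h b - h t) \<le> B * norm (b - t)"
          using ab t by (intro lipschitz_on_normD[OF lip]) auto
        also have "\<dots> \<le> B * d" using ab t B by (intro mult_left_mono) auto
        finally show "norm (h b - h t) \<le> B * d" .
      qed (use ab ca in \<open>auto intro!: continuous_intros\<close>)
      finally show ?thesis using ab by (simp add: power2_eq_square mult.assoc)
    qed
    moreover have "\<bar>d * (\<Sum>k=1..j. h (real k * d)) - integral {0..a} h\<bar> \<le> real j * (B * d\<^sup>2)"
      using Suc by (simp add: a_def)
    ultimately have "\<bar>d * ((\<Sum>k=1..j. h (real k * d)) + h b) - integral {0..b} h\<bar> \<le> real j * (B * d\<^sup>2) + B * d\<^sup>2"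
      by (simp add: distrib_left)
    then show ?case by (simp add: b_def distrib_right)
  qed simp
  from this[of n] d show ?thesis
    using n by (simp add: d_def power2_eq_square)
qed

context
  fixes P :: "(real ^ 'p) set" and T L B :: real and u :: "(real ^ 'p) \<times> real \<Rightarrow> real ^ 'h"
  assumes P: "compact P" and Ppos: "emeasure lborel P > 0" and T: "T > 0"
    and lip: "L-lipschitz_on (P \<times> {0..T}) u" and B: "\<And>x. x \<in> P \<times> {0..T} \<Longrightarrow> norm (u x) \<le> B"
begin

text \<open>The limit of the time sums for a single parameter. Extension by 0 outside
  \<open>P\<close> makes it a function on the whole parameter space, to which Fubini's theorem
  applies directly.\<close>

definition time_int :: "'h \<Rightarrow> 'h \<Rightarrow> real ^ 'p \<Rightarrow> real" where
  "time_int a b y = (LINT t|lborel. indicator (P \<times> {0..T}) (y, t) *\<^sub>R (u (y, t) $ a * u (y, t) $ b))"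

lemma continuous_solution: "continuous_on (P \<times> {0..T}) u"
  using lip by (rule lipschitz_on_continuous_on)

lemma emeasure_parameters: "emeasure lborel P = ennreal (measure lborel P)"
  using emeasure_bounded_finite[OF compact_imp_bounded[OF P]]
  by (intro emeasure_eq_ennreal_measure) auto

lemma measure_parameters_pos: "0 < measure lborel P"
  using Ppos unfolding emeasure_parameters by simp

lemma product_integrable: "integrable lborel (\<lambda>z. indicator (P \<times> {0..T}) z *\<^sub>R (u z $ a * u z $ b))"
  unfolding set_integrable_def[symmetric]
  by (intro set_integrable_compact compact_domain P continuous_intros continuous_solution)

lemma time_int_measurable[measurable]: "time_int a b \<in> borel_measurable borel"
proof -
  have "(\<lambda>z. indicator (P \<times> {0..T}) z *\<^sub>R (u z $ a * u z $ b)) \<in> borel_measurable (borel \<Otimes>\<^sub>M borel)"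
    using product_integrable[of a b] by (simp add: borel_prod integrable_iff_bounded)
  then have "(\<lambda>(y, t). indicator (P \<times> {0..T}) (y, t) *\<^sub>R (u (y, t) $ a * u (y, t) $ b)) \<in> borel_measurable (borel \<Otimes>\<^sub>M lborel)"
    by (simp add: case_prod_unfold cong: measurable_cong_sets)
  then show ?thesis
    unfolding time_int_def by (rule lborel.borel_measurable_lebesgue_integral)
qed

text \<open>Both components are bounded by \<open>B\<close> and \<open>L\<close>-Lipschitz in time;
  each summand of the product rule contributes \<open>B * L\<close>.\<close>

lemma product_lipschitz:
  assumes y: "y \<in> P"
  shows "(2 * B * L)-lipschitz_on {0..T} (\<lambda>t. u (y, t) $ a * u (y, t) $ b)"
proof (rule lipschitz_onI)
  have B0: "0 \<le> B" using B[of "(y, 0)"] y T by (auto intro: order_trans[OF norm_ge_zero])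
  have L0: "0 \<le> L" using lip by (rule lipschitz_on_nonneg)
  show "0 \<le> 2 * B * L" using B0 L0 by simp
  fix s t assume st: "s \<in> {0..T}" "t \<in> {0..T}"
  have c: "\<bar>u (y, r) $ i\<bar> \<le> B" if "r \<in> {0..T}" for r i
    using B[of "(y, r)"] component_le_norm_cart[of "u (y, r)" i] that y by auto
  have d: "\<bar>u (y, s) $ i - u (y, t) $ i\<bar> \<le> L * dist s t" for i
  proof -
    have "\<bar>(u (y, s) - u (y, t)) $ i\<bar> \<le> norm (u (y, s) - u (y, t))"
      by (rule component_le_norm_cart)
    also have "\<dots> \<le> L * dist (y, s) (y, t)"
      using lipschitz_onD[OF lip, of "(y, s)" "(y, t)"] st y by (simp add: dist_norm)
    finally show ?thesis by (simp add: dist_Pair_Pair)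
  qed
  have "dist (u (y, s) $ a * u (y, s) $ b) (u (y, t) $ a * u (y, t) $ b)
     = \<bar>u (y, s) $ a * (u (y, s) $ b - u (y, t) $ b) + u (y, t) $ b * (u (y, s) $ a - u (y, t) $ a)\<bar>"
    by (simp add: dist_real_def algebra_simps)
  also have "\<dots> \<le> \<bar>u (y, s) $ a\<bar> * \<bar>u (y, s) $ b - u (y, t) $ b\<bar> + \<bar>u (y, t) $ b\<bar> * \<bar>u (y, s) $ a - u (y, t) $ a\<bar>"
    by (rule order_trans[OF abs_triangle_ineq]) (simp add: abs_mult)
  also have "\<dots> \<le> B * (L * dist s t) + B * (L * dist s t)"
    using st B0 by (intro add_mono mult_mono c d) auto
  finally show "dist (u (y, s) $ a * u (y, s) $ b) (u (y, t) $ a * u (y, t) $ b) \<le> 2 * B * L * dist s t"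
    by simp
qed

lemma time_int_eq_integral:
  assumes "y \<in> P"
  shows "time_int a b y = integral {0..T} (\<lambda>t. u (y, t) $ a * u (y, t) $ b)"
proof -
  have "time_int a b y = (LINT t:{0..T}|lborel. u (y, t) $ a * u (y, t) $ b)"
    using assms by (simp add: time_int_def set_lebesgue_integral_def indicator_def cong: if_cong)
  also have "\<dots> = integral {0..T} (\<lambda>t. u (y, t) $ a * u (y, t) $ b)"
    by (intro set_borel_integral_eq_integral(2) set_integrable_compact
        lipschitz_on_continuous_on[OF product_lipschitz] assms) auto
  finally show ?thesis .
qed

lemma time_int_bound:
  assumes y: "y \<in> P"
  shows "\<bar>time_int a b y\<bar> \<le> B\<^sup>2 * T"
proof -
  have "norm (integral {0..T} (\<lambda>t. u (y, t) $ a * u (y, t) $ b)) \<le> B\<^sup>2 * (T - 0)"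
  proof (rule integral_bound)
    show "continuous_on {0..T} (\<lambda>t. u (y, t) $ a * u (y, t) $ b)"
      by (rule lipschitz_on_continuous_on[OF product_lipschitz[OF y]])
    fix t assume t: "t \<in> {0..T}"
    have "\<bar>u (y, t) $ i\<bar> \<le> B" for i
      using B[of "(y, t)"] component_le_norm_cart[of "u (y, t)" i] t y by auto
    then show "norm (u (y, t) $ a * u (y, t) $ b) \<le> B\<^sup>2"
      unfolding real_norm_def abs_mult power2_eq_square
      by (intro mult_mono) (auto intro: order_trans[OF abs_ge_zero])
  qed (use T in auto)
  then show ?thesis by (simp add: time_int_eq_integral[OF y])
qed

lemma integral_time_int: "(LINT y|lborel. time_int a b y) = corr_matrix_inf P T u $ a $ b"
proof -
  have "integrable (lborel \<Otimes>\<^sub>M lborel) (\<lambda>z. indicator (P \<times> {0..T}) z *\<^sub>R (u z $ a * u z $ b))"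
    unfolding lborel_prod by (rule product_integrable)
  from lborel_pair.integral_fst'[OF this] show ?thesis
    unfolding time_int_def corr_matrix_inf_def set_lebesgue_integral_def lborel_prod by simp
qed

lemma expectation_time_int:
  assumes rv: "X \<in> borel_measurable M" and distr: "distr M borel X = uniform_measure lborel P"
  shows "(LINT \<omega>|M. time_int a b (X \<omega>)) = corr_matrix_inf P T u $ a $ b / measure lborel P"
proof -
  have PB[measurable]: "P \<in> sets borel" using P by (simp add: compact_imp_closed)
  have "(LINT \<omega>|M. time_int a b (X \<omega>)) = (LINT y|distr M borel X. time_int a b y)"
    by (rule integral_distr[symmetric]) (use rv in auto)
  also have "distr M borel X = density lborel (\<lambda>y. ennreal (indicator P y / measure lborel P))"
    unfolding distr uniform_measure_def emeasure_parameters using measure_parameters_pos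
    by (intro density_cong) (auto simp: indicator_def divide_ennreal simp flip: ennreal_1)
  also have "(LINT y|\<dots>. time_int a b y) = (LINT y|lborel. (indicator P y / measure lborel P) *\<^sub>R time_int a b y)"
    using measure_parameters_pos by (intro integral_density) auto
  \<comment> \<open>The indicator may be dropped because \<open>time_int\<close> already vanishes
    outside \<open>P\<close>.\<close>
  also have "\<dots> = (LINT y|lborel. time_int a b y / measure lborel P)"
    by (intro Bochner_Integration.integral_cong) (auto simp: indicator_def time_int_def)
  finally show ?thesis by (simp add: integral_time_int)
qed

lemma measure_domain: "measure lborel (P \<times> {0..T}) = measure lborel P * T"
proof -
  have "P \<in> sets lborel" using P by (simp add: compact_imp_closed)
  then have "emeasure lborel (P \<times> {0..T}) = emeasure lborel P * emeasure lborel {0..T}"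
    unfolding lborel_prod[symmetric] by (intro lborel.emeasure_pair_measure_Times) auto
  then show ?thesis using T by (simp add: measure_def enn2real_mult)
qed

text \<open>Deterministic and uniform over all samples in \<open>P\<close>. The factor
  \<open>measure lborel P * T / (Ns * Nt)\<close> splits into a mean over the samples and the step
  of the time grid, so each sample carries one Riemann error.\<close>

lemma corr_matrix_entry_error:
  assumes \<theta>: "\<And>j. 1 \<le> j \<Longrightarrow> \<theta> j \<in> P" and N: "1 \<le> Ns" "1 \<le> Nt"
  shows "\<bar>corr_matrix P T u Ns Nt \<theta> $ a $ b - measure lborel P * ((\<Sum>j=1..Ns. time_int a b (\<theta> j)) / real Ns)\<bar>
    \<le> measure lborel P * (2 * B * L * T\<^sup>2 / real Nt)"
proof -
  let ?g = "\<lambda>y t. u (y, t) $ a * u (y, t) $ b"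
  let ?R = "\<lambda>j. T / real Nt * (\<Sum>k=1..Nt. ?g (\<theta> j) (real k * (T / real Nt)))"
  have "corr_matrix P T u Ns Nt \<theta> $ a $ b = measure lborel P * T / real (Ns * Nt) *
      (\<Sum>j=1..Ns. \<Sum>k=1..Nt. ?g (\<theta> j) (real k * (T / real Nt)))"
  proof -
    have "(\<Sum>c\<in>{1..Ns} \<times> {1..Nt}. snapshots T u Ns Nt \<theta> c $ a * snapshots T u Ns Nt \<theta> c $ b)
        = (\<Sum>(j, k)\<in>{1..Ns} \<times> {1..Nt}. ?g (\<theta> j) (real k * (T / real Nt)))"
      by (intro sum.cong refl) (auto simp: snapshots_def)
    then show ?thesis
      by (simp only: corr_matrix_def measure_domain sum.cartesian_product vector_scaleR_component
          vec_lambda_beta real_scaleR_def)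
  qed
  also have "\<dots> = measure lborel P / real Ns * (\<Sum>j=1..Ns. ?R j)"
    by (simp add: sum_distrib_left mult.assoc)
  finally have eq: "corr_matrix P T u Ns Nt \<theta> $ a $ b - measure lborel P * ((\<Sum>j=1..Ns. time_int a b (\<theta> j)) / real Ns)
    = measure lborel P / real Ns * (\<Sum>j=1..Ns. ?R j - time_int a b (\<theta> j))"
    unfolding sum_subtractf by (simp only: right_diff_distrib times_divide_eq_left times_divide_eq_right)
  have "\<bar>measure lborel P / real Ns * (\<Sum>j=1..Ns. ?R j - time_int a b (\<theta> j))\<bar>
    = measure lborel P / real Ns * \<bar>\<Sum>j=1..Ns. ?R j - time_int a b (\<theta> j)\<bar>"
    unfolding abs_mult by (simp only: abs_of_nonneg divide_nonneg_nonneg measure_nonneg of_nat_0_le_iff)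
  also have "\<dots> \<le> measure lborel P / real Ns * (\<Sum>j=1..Ns. 2 * B * L * T\<^sup>2 / real Nt)"
  proof (intro mult_left_mono order_trans[OF sum_abs] sum_mono)
    fix j assume "j \<in> {1..Ns}"
    then have "\<theta> j \<in> P" using \<theta> by auto
    then show "\<bar>?R j - time_int a b (\<theta> j)\<bar> \<le> 2 * B * L * T\<^sup>2 / real Nt"
      using riemann_sum_error[OF product_lipschitz[of "\<theta> j"] T N(2)] by (simp add: time_int_eq_integral)
  qed auto
  also have "\<dots> = measure lborel P * (2 * B * L * T\<^sup>2 / real Nt)"
    using N by simp
  finally show ?thesis unfolding eq .
qed

text \<open>The first summand involves only \<open>Nt\<close>, the second only \<open>Ns\<close> and
  the sample; the joint limit and the sum of two rates rest on this separation. The square of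
  \<open>CARD('h)\<close> counts matrix entries.\<close>

lemma norm_corr_matrix_error:
  assumes \<theta>: "\<And>j. 1 \<le> j \<Longrightarrow> \<theta> j \<in> P" and N: "1 \<le> Ns" "1 \<le> Nt"
  shows "norm (corr_matrix P T u Ns Nt \<theta> - corr_matrix_inf P T u)
    \<le> (real CARD('h))\<^sup>2 * measure lborel P * (2 * B * L * T\<^sup>2) / real Nt
     + measure lborel P * (\<Sum>a\<in>UNIV. \<Sum>b\<in>UNIV.
        \<bar>(\<Sum>j=1..Ns. time_int a b (\<theta> j)) / real Ns - corr_matrix_inf P T u $ a $ b / measure lborel P\<bar>)"
proof -
  let ?p = "measure lborel P"
  let ?D = "corr_matrix P T u Ns Nt \<theta> - corr_matrix_inf P T u"
  let ?r = "\<lambda>a b. (\<Sum>j=1..Ns. time_int a b (\<theta> j)) / real Ns - corr_matrix_inf P T u $ a $ b / ?p"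
  have entry: "\<bar>?D $ a $ b\<bar> \<le> ?p * (2 * B * L * T\<^sup>2 / real Nt) + ?p * \<bar>?r a b\<bar>" for a b
  proof -
    have eq: "?D $ a $ b = (corr_matrix P T u Ns Nt \<theta> $ a $ b - ?p * ((\<Sum>j=1..Ns. time_int a b (\<theta> j)) / real Ns)) + ?p * ?r a b"
      using measure_parameters_pos by (simp add: right_diff_distrib)
    show ?thesis
      unfolding eq
      using measure_parameters_pos corr_matrix_entry_error[of \<theta> Ns Nt a b, OF \<theta> N]
      by (intro order_trans[OF abs_triangle_ineq] add_mono) (auto simp: abs_mult)
  qed
  have "norm ?D \<le> (\<Sum>a\<in>UNIV. norm (?D $ a))"
    unfolding norm_vec_def[of ?D] by (rule L2_set_le_sum) auto
  also have "\<dots> \<le> (\<Sum>a\<in>UNIV. \<Sum>b\<in>UNIV. \<bar>?D $ a $ b\<bar>)"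
    by (intro sum_mono norm_le_l1_cart)
  also have "\<dots> \<le> (\<Sum>a\<in>(UNIV :: 'h set). \<Sum>b\<in>(UNIV :: 'h set). ?p * (2 * B * L * T\<^sup>2 / real Nt) + ?p * \<bar>?r a b\<bar>)"
    by (intro sum_mono entry)
  also have "\<dots> = (real CARD('h))\<^sup>2 * ?p * (2 * B * L * T\<^sup>2) / real Nt + ?p * (\<Sum>a\<in>UNIV. \<Sum>b\<in>UNIV. \<bar>?r a b\<bar>)"
    by (simp add: sum.distrib sum_distrib_left power2_eq_square mult_ac)
  finally show ?thesis .
qed

end

section \<open>Joint limits in \<open>Ns\<close> and \<open>Nt\<close>, and the error
  estimate\<close>

lemma eventually_prod_sequentially_ge:
  assumes "\<And>Ns Nt. a \<le> Ns \<Longrightarrow> b \<le> Nt \<Longrightarrow> Q (Ns, Nt)"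
  shows "eventually Q (sequentially \<times>\<^sub>F sequentially)"
  unfolding eventually_prod_filter
  using assms eventually_ge_at_top[of a] eventually_ge_at_top[of b] by blast

lemma filterlim_fst_prod: "filterlim fst F (F \<times>\<^sub>F G)"
  by (simp add: filterlim_def filtermap_fst_prod_filter)

lemma filterlim_snd_prod: "filterlim snd G (F \<times>\<^sub>F G)"
  by (simp add: filterlim_def filtermap_snd_prod_filter)

text \<open>\<open>pod\<close> is an arbitrary selection of left singular vectors. Its only inputs
  are the sizes and the snapshot matrix, which builds into the formulation that \<open>V\<close>
  depends on the training data alone. The product filter lets \<open>Ns\<close> and
  \<open>Nt\<close> grow without any coupling.\<close>

theorem theorem3p1:
  fixes P :: "(real ^ 'p) set" and T L :: real
    and u :: "(real ^ 'p) \<times> real \<Rightarrow> real ^ 'h"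
    and M :: "'w measure" and \<mu> :: "nat \<Rightarrow> 'w \<Rightarrow> real ^ 'p"
    and pod :: "nat \<Rightarrow> nat \<Rightarrow> (nat \<times> nat \<Rightarrow> real ^ 'h) \<Rightarrow> real ^ 'n ^ 'h"
    and V :: "nat \<Rightarrow> nat \<Rightarrow> 'w \<Rightarrow> real ^ 'n ^ 'h"
  assumes "CARD('n) \<le> CARD('h)"
    and "compact P" and "emeasure lborel P > 0" and "T > 0"
    and "prob_space M"
    and "prob_space.indep_vars M (\<lambda>_. borel) \<mu> {1..}"
    and "\<And>j. j \<ge> 1 \<Longrightarrow> distr M borel (\<mu> j) = uniform_measure lborel P"
    and "\<And>j \<omega>. j \<ge> 1 \<Longrightarrow> \<omega> \<in> space M \<Longrightarrow> \<mu> j \<omega> \<in> P"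
    and "sol_essinf P T u > 0" and "sol_esssup P T u < \<infinity>"
    and "L > 0" and "L-lipschitz_on (P \<times> {0..T}) u"
    and pod: "\<And>Ns Nt U. Ns \<ge> 1 \<Longrightarrow> Nt \<ge> 2 \<Longrightarrow>
           is_pod_matrix ({1..Ns} \<times> {1..Nt}) U (pod Ns Nt U)"
    and V: "\<And>Ns Nt \<omega>. V Ns Nt \<omega> = pod Ns Nt (snapshots T u Ns Nt (\<lambda>j. \<mu> j \<omega>))"
  shows
    "(\<forall>Ns\<ge>1. \<forall>Nt\<ge>2. \<forall>\<omega>\<in>space M. \<forall>q. neural_network q \<longrightarrow>
        err_R P T u (V Ns Nt \<omega>) q
          \<le> err_S P T u (V Ns Nt \<omega>) Ns Nt (\<lambda>j. \<mu> j \<omega>)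
            + err_POD P T u CARD('n) Ns Nt (\<lambda>j. \<mu> j \<omega>)
            + err_NN P T u (V Ns Nt \<omega>) q)
     \<and> (AE \<omega> in M. ((\<lambda>(Ns, Nt). err_S P T u (V Ns Nt \<omega>) Ns Nt (\<lambda>j. \<mu> j \<omega>))
            \<longlongrightarrow> 0) (sequentially \<times>\<^sub>F sequentially))
     \<and> ((\<forall>Ns\<ge>1. \<forall>Nt\<ge>2. V Ns Nt \<in> borel_measurable M) \<longrightarrow>
          (\<forall>Ns\<ge>1. \<forall>Nt\<ge>2.
             integrable M (\<lambda>\<omega>. err_S P T u (V Ns Nt \<omega>) Ns Nt (\<lambda>j. \<mu> j \<omega>)))
          \<and> (\<lambda>(Ns, Nt). LINT \<omega>|M. err_S P T u (V Ns Nt \<omega>) Ns Nt (\<lambda>j. \<mu> j \<omega>))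
              \<in> O[sequentially \<times>\<^sub>F sequentially](\<lambda>(Ns, Nt).
                   real Ns powr (- (1 / 4)) + real Nt powr (- (1 / 2))))
     \<and> (AE \<omega> in M. ((\<lambda>(Ns, Nt). err_POD P T u CARD('n) Ns Nt (\<lambda>j. \<mu> j \<omega>))
            \<longlongrightarrow> err_POD_inf P T u CARD('n)) (sequentially \<times>\<^sub>F sequentially))
     \<and> (\<forall>Ns\<ge>1. \<forall>Nt\<ge>2. \<forall>\<omega>\<in>space M. \<forall>\<eta>>0. \<exists>q.
            neural_network q \<and> err_NN P T u (V Ns Nt \<omega>) q < \<eta>)"
proof -
  interpret prob_space M by fact
  note N = assms(1) and P = assms(2) and Ppos = assms(3) and T = assms(4) and indep = assms(6)
    and distr = assms(7) and \<mu>P = assms(8) and essinf = assms(9) and lip = assms(12)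
  have cont: "continuous_on (P \<times> {0..T}) u"
    using lip by (rule lipschitz_on_continuous_on)
  obtain B where B: "\<And>x. x \<in> P \<times> {0..T} \<Longrightarrow> norm (u x) \<le> B"
    using compact_imp_bounded[OF compact_continuous_image[OF cont compact_domain[OF P]]]
    unfolding bounded_iff by blast
  define m where "m = real_of_ereal (sol_essinf P T u)"
  have m: "0 < m"
    unfolding m_def by (rule sol_essinf_bounds(1)[OF P Ppos T essinf])
  define H where "H = real CARD('h)"
  define p where "p = measure lborel P"
  have p: "0 < p" unfolding p_def by (rule measure_parameters_pos[OF P Ppos T lip B])
  have rv[measurable]: "\<mu> j \<in> borel_measurable M" if "1 \<le> j" for j
    using indep that by (simp add: indep_vars_def)

  define K where "K Ns Nt \<omega> = corr_matrix P T u Ns Nt (\<lambda>j. \<mu> j \<omega>)" for Ns Nt \<omega>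
  define Kinf where "Kinf = corr_matrix_inf P T u"
  have pod': "(\<exists>w l. eigbasis (K Ns Nt \<omega>) w l)
      \<and> eigtail CARD('n) (K Ns Nt \<omega>) = K Ns Nt \<omega> \<bullet> coproj (V Ns Nt \<omega>)
      \<and> transpose (V Ns Nt \<omega>) ** V Ns Nt \<omega> = mat 1 \<and> 0 \<le> eigtail CARD('n) (K Ns Nt \<omega>)"
    if "1 \<le> Ns" "2 \<le> Nt" for Ns Nt \<omega>
    unfolding K_def corr_matrix_eq_gram V
    by (intro conjI pod_matrix[OF pod[OF that] _ _ N]) auto
  have errS: "err_S P T u (V Ns Nt \<omega>) Ns Nt (\<lambda>j. \<mu> j \<omega>)
      = inverse m * sqrt \<bar>(Kinf - K Ns Nt \<omega>) \<bullet> coproj (V Ns Nt \<omega>)\<bar>"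
    if "1 \<le> Ns" "2 \<le> Nt" for Ns Nt \<omega>
    unfolding err_S_def eigtail_def[symmetric] m_def[symmetric] K_def[symmetric]
      integral_residual[OF P Ppos T essinf cont pod'[OF that, THEN conjunct2, THEN conjunct2, THEN conjunct1]]
    using pod'[OF that, of \<omega>] by (simp add: inner_diff_left Kinf_def)
  have errS_le: "err_S P T u (V Ns Nt \<omega>) Ns Nt (\<lambda>j. \<mu> j \<omega>) \<le> inverse m * sqrt (H * norm (K Ns Nt \<omega> - Kinf))"
    if "1 \<le> Ns" "2 \<le> Nt" for Ns Nt \<omega>
  proof -
    have "\<bar>(Kinf - K Ns Nt \<omega>) \<bullet> coproj (V Ns Nt \<omega>)\<bar> \<le> norm (Kinf - K Ns Nt \<omega>) * norm (coproj (V Ns Nt \<omega>))"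
      by (rule Cauchy_Schwarz_ineq2)
    also have "\<dots> \<le> norm (Kinf - K Ns Nt \<omega>) * H"
      unfolding H_def using pod'[OF that, of \<omega>] by (intro mult_left_mono norm_coproj_le) auto
    finally show ?thesis
      unfolding errS[OF that] using m
      by (intro mult_left_mono real_sqrt_le_mono) (auto simp: norm_minus_commute mult.commute)
  qed

  \<comment> \<open>Each variable is a function of one sample and does not involve
    \<open>Nt\<close>, so the null set discarded below does not depend on \<open>Nt\<close>
    either.\<close>
  define X where "X a b j \<omega> = time_int P T u a b (\<mu> j \<omega>)" for a b j \<omega>
  define R where "R Ns \<omega> = (\<Sum>a\<in>UNIV. \<Sum>b\<in>UNIV. \<bar>(\<Sum>j=1..Ns. X a b j \<omega>) / real Ns - Kinf $ a $ b / p\<bar>)" for Ns \<omega>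
  define C where "C = H\<^sup>2 * p * (2 * B * L * T\<^sup>2)"
  have K_le: "norm (K Ns Nt \<omega> - Kinf) \<le> C / real Nt + p * R Ns \<omega>"
    if "1 \<le> Ns" "1 \<le> Nt" "\<omega> \<in> space M" for Ns Nt \<omega>
    unfolding K_def Kinf_def C_def H_def p_def R_def X_def
    using norm_corr_matrix_error[OF P Ppos T lip B _ that(1,2), of "\<lambda>j. \<mu> j \<omega>"] \<mu>P that(3) by simp
  have Xindep: "indep_vars (\<lambda>_. borel) (X a b) {1..}" for a b
    unfolding X_def[abs_def]
    by (rule indep_vars_compose2[OF indep]) (rule time_int_measurable[OF P Ppos T lip B])
  have Xbound: "\<bar>X a b j \<omega>\<bar> \<le> B\<^sup>2 * T" if "1 \<le> j" "\<omega> \<in> space M" for a b j \<omega>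
    unfolding X_def by (rule time_int_bound[OF P Ppos T lip B \<mu>P[OF that]])
  have Xmean: "expectation (X a b j) = Kinf $ a $ b / p" if "1 \<le> j" for a b j
    unfolding X_def Kinf_def p_def by (rule expectation_time_int[OF P Ppos T lip B rv[OF that] distr[OF that]])

  have "AE \<omega> in M. \<forall>a b. (\<lambda>n. (\<Sum>j=1..n. X a b j \<omega>) / real n) \<longlonglongrightarrow> Kinf $ a $ b / p"
    unfolding AE_all_countable
    by (intro allI strong_law_bounded[OF Xindep Xbound Xmean])
  then have K_tendsto: "AE \<omega> in M. ((\<lambda>(Ns, Nt). norm (K Ns Nt \<omega> - Kinf)) \<longlongrightarrow> 0) (sequentially \<times>\<^sub>F sequentially)"
    using AE_space
  proof eventually_elim
    case (elim \<omega>)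
    have "(\<lambda>n. R n \<omega>) \<longlonglongrightarrow> (\<Sum>a\<in>UNIV. \<Sum>b\<in>UNIV. \<bar>Kinf $ a $ b / p - Kinf $ a $ b / p\<bar>)"
      unfolding R_def by (intro tendsto_sum tendsto_rabs tendsto_diff tendsto_const elim(1)[rule_format])
    then have R: "(\<lambda>n. R n \<omega>) \<longlonglongrightarrow> 0" by simp
    \<comment> \<open>Each summand is a null sequence in one index, hence tends to 0 along the
      product filter.\<close>
    have "((\<lambda>z. C / real (snd z) + p * R (fst z) \<omega>) \<longlongrightarrow> 0 + p * 0) (sequentially \<times>\<^sub>F sequentially)"
      by (intro tendsto_add tendsto_mult tendsto_const
          filterlim_compose[OF lim_const_over_n filterlim_snd_prod] filterlim_compose[OF R filterlim_fst_prod])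
    then show ?case
      unfolding mult_zero_right add_0_right
    proof (rule Lim_null_comparison[rotated])
      show "\<forall>\<^sub>F z in sequentially \<times>\<^sub>F sequentially. norm (case z of (Ns, Nt) \<Rightarrow> norm (K Ns Nt \<omega> - Kinf)) \<le> C / real (snd z) + p * R (fst z) \<omega>"
        using K_le elim(2) by (intro eventually_prod_sequentially_ge[of 1 1]) auto
    qed
  qed

  have claim1: "err_R P T u (V Ns Nt \<omega>) q
          \<le> err_S P T u (V Ns Nt \<omega>) Ns Nt (\<lambda>j. \<mu> j \<omega>)
            + err_POD P T u CARD('n) Ns Nt (\<lambda>j. \<mu> j \<omega>)
            + err_NN P T u (V Ns Nt \<omega>) q"
    if "1 \<le> Ns" "2 \<le> Nt" "neural_network q" for Ns Nt \<omega> q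
    using pod'[OF that(1,2), of \<omega>] unfolding K_def
    by (intro err_R_le[OF P Ppos T essinf cont _ _ that(3)]) auto

  have claim2: "AE \<omega> in M. ((\<lambda>(Ns, Nt). err_S P T u (V Ns Nt \<omega>) Ns Nt (\<lambda>j. \<mu> j \<omega>))
            \<longlongrightarrow> 0) (sequentially \<times>\<^sub>F sequentially)"
    using K_tendsto
  proof eventually_elim
    case (elim \<omega>)
    then have "((\<lambda>z. inverse m * sqrt (H * (case z of (Ns, Nt) \<Rightarrow> norm (K Ns Nt \<omega> - Kinf)))) \<longlongrightarrow> inverse m * sqrt (H * 0))
        (sequentially \<times>\<^sub>F sequentially)"
      by (intro tendsto_intros)
    then have lim: "((\<lambda>z. inverse m * sqrt (H * (case z of (Ns, Nt) \<Rightarrow> norm (K Ns Nt \<omega> - Kinf)))) \<longlongrightarrow> 0)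
        (sequentially \<times>\<^sub>F sequentially)" by simp
    show ?case
    proof (rule tendsto_sandwich[OF _ _ tendsto_const lim])
      show "\<forall>\<^sub>F z in sequentially \<times>\<^sub>F sequentially. 0 \<le> (case z of (Ns, Nt) \<Rightarrow> err_S P T u (V Ns Nt \<omega>) Ns Nt (\<lambda>j. \<mu> j \<omega>))"
        using m by (intro eventually_prod_sequentially_ge[of 1 2]) (auto simp: errS)
      show "\<forall>\<^sub>F z in sequentially \<times>\<^sub>F sequentially. (case z of (Ns, Nt) \<Rightarrow> err_S P T u (V Ns Nt \<omega>) Ns Nt (\<lambda>j. \<mu> j \<omega>))
          \<le> inverse m * sqrt (H * (case z of (Ns, Nt) \<Rightarrow> norm (K Ns Nt \<omega> - Kinf)))"
        using errS_le by (intro eventually_prod_sequentially_ge[of 1 2]) auto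
    qed
  qed

  have claim4: "AE \<omega> in M. ((\<lambda>(Ns, Nt). err_POD P T u CARD('n) Ns Nt (\<lambda>j. \<mu> j \<omega>))
            \<longlongrightarrow> err_POD_inf P T u CARD('n)) (sequentially \<times>\<^sub>F sequentially)"
  proof -
    \<comment> \<open>The hypothesis on \<open>pod\<close> provides a singular value decomposition of every snapshot matrix,
      in particular of \<open>Kinf\<close> itself, padded with zero columns to have the shape of one.\<close>
    obtain w l where Kinf_eig: "eigbasis Kinf w l"
    proof -
      obtain e where e: "bij_betw e {1..CARD('h)} (UNIV :: 'h set)"
        using finite_same_card_bij[of "{1..CARD('h)}" "UNIV :: 'h set"] by auto
      define U where "U = (\<lambda>(j, k). if k = (1::nat) then column (e j) Kinf else 0)"
      have sym: "transpose Kinf = Kinf"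
        unfolding Kinf_def by (rule corr_matrix_inf_symmetric)
      \<comment> \<open>2 is the least number of times covered by the hypothesis, so every column of
        \<open>Kinf\<close> is paired with one zero column.\<close>
      have "is_pod_matrix ({1..CARD('h)} \<times> {1..2}) U (pod CARD('h) 2 U)"
        by (rule pod) (auto simp: Suc_leI)
      then obtain w s z where svd: "is_svd ({1..CARD('h)} \<times> {1..2}) U w s z"
        unfolding is_pod_matrix_def by blast
      have "gram ({1..CARD('h)} \<times> {1..2}) U $ a $ b = (Kinf ** Kinf) $ a $ b" for a b
      proof -
        have "gram ({1..CARD('h)} \<times> {1..2}) U $ a $ b
          = (\<Sum>j=1..CARD('h). \<Sum>k=1..2. U (j, k) $ a * U (j, k) $ b)"
          by (simp only: gram_def vec_lambda_beta sum.cartesian_product case_prod_unfold prod.collapse)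
        also have "\<dots> = (\<Sum>j=1..CARD('h). Kinf $ a $ e j * Kinf $ b $ e j)"
        proof (intro sum.cong refl)
          fix j
          have "{1..2::nat} = {1, 2}" by auto
          then show "(\<Sum>k=1..2. U (j, k) $ a * U (j, k) $ b) = Kinf $ a $ e j * Kinf $ b $ e j"
            by (simp add: U_def column_def)
        qed
        also have "\<dots> = (\<Sum>i\<in>UNIV. Kinf $ a $ i * transpose Kinf $ i $ b)"
          using sum.reindex_bij_betw[OF e, of "\<lambda>i. Kinf $ a $ i * Kinf $ b $ i"] by (simp add: transpose_def)
        finally show ?thesis by (simp add: sym matrix_matrix_mult_def)
      qed
      then have "gram ({1..CARD('h)} \<times> {1..2}) U = Kinf ** Kinf" by (simp add: vec_eq_iff)
      from eigbasis_psd[OF svd _ this sym] show ?thesis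
        using corr_matrix_inf_psd[OF P Ppos T essinf cont] that unfolding Kinf_def by blast
    qed
    show ?thesis
      using K_tendsto
    proof eventually_elim
      case (elim \<omega>)
      have "((\<lambda>z. (case z of (Ns, Nt) \<Rightarrow> eigtail CARD('n) (K Ns Nt \<omega>)) - eigtail CARD('n) Kinf) \<longlongrightarrow> 0)
          (sequentially \<times>\<^sub>F sequentially)"
      proof (rule Lim_null_comparison)
        show "((\<lambda>z. H * (case z of (Ns, Nt) \<Rightarrow> norm (K Ns Nt \<omega> - Kinf))) \<longlongrightarrow> 0) (sequentially \<times>\<^sub>F sequentially)"
          using tendsto_mult_left[OF elim, of H] by simp
        show "\<forall>\<^sub>F z in sequentially \<times>\<^sub>F sequentially.
            norm ((case z of (Ns, Nt) \<Rightarrow> eigtail CARD('n) (K Ns Nt \<omega>)) - eigtail CARD('n) Kinf)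
              \<le> H * (case z of (Ns, Nt) \<Rightarrow> norm (K Ns Nt \<omega> - Kinf))"
        proof (rule eventually_prod_sequentially_ge[of 1 2])
          fix Ns Nt :: nat assume "1 \<le> Ns" "2 \<le> Nt"
          then obtain w' l' where "eigbasis (K Ns Nt \<omega>) w' l'" using pod' by blast
          then show "norm ((case (Ns, Nt) of (Ns, Nt) \<Rightarrow> eigtail CARD('n) (K Ns Nt \<omega>)) - eigtail CARD('n) Kinf)
              \<le> H * (case (Ns, Nt) of (Ns, Nt) \<Rightarrow> norm (K Ns Nt \<omega> - Kinf))"
            using abs_eigtail_diff_le[OF _ Kinf_eig N] by (simp add: H_def)
        qed
      qed
      then have "((\<lambda>z. case z of (Ns, Nt) \<Rightarrow> eigtail CARD('n) (K Ns Nt \<omega>)) \<longlongrightarrow> eigtail CARD('n) Kinf)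
          (sequentially \<times>\<^sub>F sequentially)"
        by (rule LIM_zero_cancel)
      then have "((\<lambda>z. inverse m * sqrt (case z of (Ns, Nt) \<Rightarrow> eigtail CARD('n) (K Ns Nt \<omega>)))
          \<longlongrightarrow> inverse m * sqrt (eigtail CARD('n) Kinf)) (sequentially \<times>\<^sub>F sequentially)"
        by (intro tendsto_intros)
      then show ?case
        by (simp add: err_POD_def err_POD_inf_def eigtail_def m_def K_def Kinf_def case_prod_unfold)
    qed
  qed

  have claim5: "\<exists>q. neural_network q \<and> err_NN P T u (V Ns Nt \<omega>) q < \<eta>"
    if "1 \<le> Ns" "2 \<le> Nt" "0 < \<eta>" for Ns Nt \<omega> \<eta>
    using pod'[OF that(1,2), of \<omega>] by (intro err_NN_small[OF P Ppos T essinf cont _ that(3)]) auto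

  have claim3: "(\<forall>Ns\<ge>1. \<forall>Nt\<ge>2. integrable M (\<lambda>\<omega>. err_S P T u (V Ns Nt \<omega>) Ns Nt (\<lambda>j. \<mu> j \<omega>)))
      \<and> (\<lambda>(Ns, Nt). LINT \<omega>|M. err_S P T u (V Ns Nt \<omega>) Ns Nt (\<lambda>j. \<mu> j \<omega>))
          \<in> O[sequentially \<times>\<^sub>F sequentially](\<lambda>(Ns, Nt). real Ns powr (- (1 / 4)) + real Nt powr (- (1 / 2)))"
    if Vmeas: "\<forall>Ns\<ge>1. \<forall>Nt\<ge>2. V Ns Nt \<in> borel_measurable M"
  proof -
    let ?E = "\<lambda>Ns Nt \<omega>. err_S P T u (V Ns Nt \<omega>) Ns Nt (\<lambda>j. \<mu> j \<omega>)"
    define D where "D = 2 * (B\<^sup>2 * T)"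
    have Xm[measurable]: "X a b j \<in> borel_measurable M" if "1 \<le> j" for a b j
      using Xindep that by (simp add: indep_vars_def)
    have Rm[measurable]: "R n \<in> borel_measurable M" for n
      unfolding R_def by measurable
    have B0: "0 \<le> B" 
    proof -
      obtain \<omega> where "\<omega> \<in> space M" using not_empty by blast
      then show ?thesis using B[of "(\<mu> 1 \<omega>, 0)"] \<mu>P[of 1 \<omega>] T by (auto intro: order_trans[OF norm_ge_zero])
    qed
    have D0: "0 \<le> D" using T by (simp add: D_def)
    have C0: "0 \<le> C" using B0 p assms(11) by (simp add: C_def)
    have R0: "0 \<le> R n \<omega>" for n \<omega> unfolding R_def by (intro sum_nonneg) auto
    have dev: "\<bar>(\<Sum>j=1..n. X a b j \<omega>) / real n - Kinf $ a $ b / p\<bar> \<le> D" if "1 \<le> n" "\<omega> \<in> space M" for n a b \<omega>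
    proof -
      have "\<bar>\<Sum>j=1..n. X a b j \<omega>\<bar> \<le> (\<Sum>j=1..n. B\<^sup>2 * T)"
        using Xbound that by (intro order_trans[OF sum_abs] sum_mono) auto
      then have "\<bar>(\<Sum>j=1..n. X a b j \<omega>) / real n\<bar> \<le> B\<^sup>2 * T"
        using that by (simp add: field_simps)
      moreover have "\<bar>Kinf $ a $ b / p\<bar> \<le> B\<^sup>2 * T"
      proof -
        have i: "integrable M (X a b 1)" using Xbound by (intro integrable_bounded[of _ "B\<^sup>2 * T"]) auto
        have "\<bar>expectation (X a b 1)\<bar> \<le> expectation (\<lambda>\<omega>. \<bar>X a b 1 \<omega>\<bar>)"
          by (rule integral_abs_bound)
        also have "\<dots> \<le> expectation (\<lambda>_. B\<^sup>2 * T)"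
          using i Xbound by (intro integral_mono) auto
        finally show ?thesis by (simp add: prob_space Xmean)
      qed
      ultimately show ?thesis unfolding D_def by linarith
    qed
    have R_le: "R n \<omega> \<le> H\<^sup>2 * D" if "1 \<le> n" "\<omega> \<in> space M" for n \<omega>
    proof -
      have "R n \<omega> \<le> (\<Sum>a\<in>(UNIV :: 'h set). \<Sum>b\<in>(UNIV :: 'h set). D)"
        unfolding R_def by (intro sum_mono dev that)
      then show ?thesis by (simp add: H_def power2_eq_square mult.assoc)
    qed
    have ER: "expectation (R n) \<le> H\<^sup>2 * D / sqrt (real n)" if "1 \<le> n" for n
    proof -
      have "integrable M (\<lambda>\<omega>. \<bar>(\<Sum>j=1..n. X a b j \<omega>) / real n - Kinf $ a $ b / p\<bar>)" for a b
        using dev that by (intro integrable_bounded[of _ D]) auto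
      then have "expectation (R n) = (\<Sum>a\<in>UNIV. \<Sum>b\<in>UNIV. expectation (\<lambda>\<omega>. \<bar>(\<Sum>j=1..n. X a b j \<omega>) / real n - Kinf $ a $ b / p\<bar>))"
        unfolding R_def by (subst Bochner_Integration.integral_sum) (auto intro!: sum.cong Bochner_Integration.integral_sum)
      also have "\<dots> \<le> (\<Sum>a\<in>(UNIV :: 'h set). \<Sum>b\<in>(UNIV :: 'h set). 2 * (B\<^sup>2 * T) / sqrt (real n))"
        by (intro sum_mono expectation_abs_mean_deviation[OF Xindep Xbound Xmean that])
      finally show ?thesis by (simp add: H_def D_def power2_eq_square mult.assoc)
    qed
    \<comment> \<open>A majorant of \<open>H * norm (K Ns Nt \<omega> - Kinf)\<close> for outcomes
      in the sample space. It is affine in \<open>R\<close>, so its expectation follows from that of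
      \<open>R\<close>.\<close>
    define Y where "Y Ns Nt \<omega> = H * (C / real Nt + p * R Ns \<omega>)" for Ns Nt \<omega>
    have H0: "0 \<le> H" by (simp add: H_def)
    have Y0: "0 \<le> Y Ns Nt \<omega>" for Ns Nt \<omega>
      unfolding Y_def using H0 C0 p R0[of Ns \<omega>] by simp
    have Y_le: "Y Ns Nt \<omega> \<le> H * (C / real Nt + p * (H\<^sup>2 * D))" if "1 \<le> Ns" "\<omega> \<in> space M" for Ns Nt \<omega>
      unfolding Y_def using H0 p R_le[OF that] by (intro mult_left_mono add_left_mono) auto
    have E_le: "?E Ns Nt \<omega> \<le> inverse m * sqrt (Y Ns Nt \<omega>)" if "1 \<le> Ns" "2 \<le> Nt" "\<omega> \<in> space M" for Ns Nt \<omega>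
    proof -
      have "sqrt (H * norm (K Ns Nt \<omega> - Kinf)) \<le> sqrt (Y Ns Nt \<omega>)"
        unfolding Y_def using K_le[of Ns Nt \<omega>] that H0 by (intro real_sqrt_le_mono mult_left_mono) auto
      then show ?thesis
        using errS_le[OF that(1,2), of \<omega>] m by (auto intro: order_trans mult_left_mono)
    qed
    have E0: "0 \<le> ?E Ns Nt \<omega>" if "1 \<le> Ns" "2 \<le> Nt" for Ns Nt \<omega>
      using m by (simp add: errS[OF that])
    have Km[measurable]: "(\<lambda>\<omega>. K Ns Nt \<omega> $ a $ b) \<in> borel_measurable M" for Ns Nt a b
    proof -
      have snap: "(\<lambda>\<omega>. snapshots T u Ns Nt (\<lambda>j. \<mu> j \<omega>) c $ i) \<in> borel_measurable M" for c i
      proof (cases "fst c \<in> {1..Ns} \<and> snd c \<in> {1..Nt}")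
        case True
        define t where "t = real (snd c) * (T / real Nt)"
        have t: "t \<in> {0..T}" using True T by (auto simp: t_def field_simps)
        have "continuous_on P (\<lambda>y. u (y, t) $ i)"
          using t by (intro continuous_intros continuous_on_compose2[OF cont]) auto
        \<comment> \<open>Off the domain nothing is known of \<open>u\<close>, not even
          measurability; the truncated function is Borel and agrees with it at the samples, which
          lie in \<open>P\<close>.\<close>
        then have "(\<lambda>y. indicator P y *\<^sub>R (u (y, t) $ i)) \<in> borel_measurable borel"
          using P by (intro borel_measurable_continuous_on_indicator) (auto simp: compact_imp_closed)
        then have "(\<lambda>\<omega>. indicator P (\<mu> (fst c) \<omega>) *\<^sub>R (u (\<mu> (fst c) \<omega>, t) $ i)) \<in> borel_measurable M"
          using True by (intro measurable_compose[OF rv]) auto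
        then show ?thesis
          by (rule measurable_cong[THEN iffD1, rotated])
             (use True \<mu>P in \<open>auto simp: snapshots_def case_prod_unfold t_def\<close>)
      qed (auto simp: snapshots_def case_prod_unfold)
      show ?thesis
        unfolding K_def corr_matrix_def using snap by simp
    qed
    have Em: "?E Ns Nt \<in> borel_measurable M" if "1 \<le> Ns" "2 \<le> Nt" for Ns Nt
    proof -
      \<comment> \<open>Measurability of \<open>V\<close> enters through \<open>coproj V\<close> in
        the formula for the sampling error.\<close>
      have Vm: "V Ns Nt \<in> borel_measurable M" using Vmeas that by blast
      have [measurable]: "(\<lambda>\<omega>. V Ns Nt \<omega> $ a $ k) \<in> borel_measurable M" for a k
        by (rule measurable_compose[OF Vm])
           (intro borel_measurable_continuous_onI continuous_intros)
      have "(\<lambda>\<omega>. (Kinf - K Ns Nt \<omega>) \<bullet> coproj (V Ns Nt \<omega>)) \<in> borel_measurable M"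
        unfolding inner_vec_def coproj_def matrix_matrix_mult_def transpose_def by simp
      then show ?thesis unfolding errS[OF that] by simp
    qed
    have Ei: "integrable M (?E Ns Nt)" if "1 \<le> Ns" "2 \<le> Nt" for Ns Nt
    proof (rule integrable_bounded[OF Em[OF that]])
      fix \<omega> assume \<omega>: "\<omega> \<in> space M"
      have "inverse m * sqrt (Y Ns Nt \<omega>) \<le> inverse m * sqrt (H * (C / real Nt + p * (H\<^sup>2 * D)))"
        using m Y_le[OF that(1) \<omega>] by (intro mult_left_mono real_sqrt_le_mono) auto
      then show "\<bar>?E Ns Nt \<omega>\<bar> \<le> inverse m * sqrt (H * (C / real Nt + p * (H\<^sup>2 * D)))"
        using E_le[OF that \<omega>] E0[OF that, of \<omega>] by simp
    qed
    define c where "c = inverse m * (sqrt (H * C) + sqrt (H * (p * (H\<^sup>2 * D))))"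
    have main: "expectation (?E Ns Nt) \<le> c * (real Ns powr (- (1 / 4)) + real Nt powr (- (1 / 2)))"
      if N: "1 \<le> Ns" "2 \<le> Nt" for Ns Nt
    proof -
      have Ym: "Y Ns Nt \<in> borel_measurable M" unfolding Y_def by measurable
      have Yb: "Y Ns Nt \<omega> \<le> H * (C / real Nt + p * (H\<^sup>2 * D))" if "\<omega> \<in> space M" for \<omega>
        using Y_le[OF N(1) that] .
      have Ri: "integrable M (R Ns)"
        using R_le[OF N(1)] R0 by (intro integrable_bounded[of _ "H\<^sup>2 * D"]) auto
      have Ysi: "integrable M (\<lambda>\<omega>. sqrt (Y Ns Nt \<omega>))"
        using Ym Yb Y0 by (intro integrable_bounded[of _ "sqrt (H * (C / real Nt + p * (H\<^sup>2 * D)))"]) auto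
      have "expectation (?E Ns Nt) \<le> expectation (\<lambda>\<omega>. inverse m * sqrt (Y Ns Nt \<omega>))"
        using Ei[OF N] Ysi E_le[OF N] by (intro integral_mono) auto
      also have "\<dots> = inverse m * expectation (\<lambda>\<omega>. sqrt (Y Ns Nt \<omega>))"
        by simp
      \<comment> \<open>With the root outside the expectation, the orders \<open>1 / Nt\<close> and
        \<open>1 / sqrt Ns\<close> of the two parts of \<open>Y\<close> turn into the powers -1/2
        and -1/4.\<close>
      also have "\<dots> \<le> inverse m * sqrt (expectation (Y Ns Nt))"
        using m Y0 Yb Ym by (intro mult_left_mono expectation_sqrt_le) auto
      also have "expectation (Y Ns Nt) = H * (C / real Nt + p * expectation (R Ns))"
        unfolding Y_def using Ri by (simp add: prob_space)
      also have "\<dots> \<le> H * (C / real Nt + p * (H\<^sup>2 * D / sqrt (real Ns)))"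
        using ER[OF N(1)] H0 p by (intro mult_left_mono add_left_mono) auto
      also have "\<dots> = H * C / real Nt + H * (p * (H\<^sup>2 * D)) / sqrt (real Ns)"
        by (simp add: distrib_left)
      also have "sqrt \<dots> \<le> sqrt (H * C / real Nt) + sqrt (H * (p * (H\<^sup>2 * D)) / sqrt (real Ns))"
        using H0 C0 p D0 by (intro sqrt_add_le_add_sqrt) auto
      also have "\<dots> = sqrt (H * C) * real Nt powr (- (1 / 2)) + sqrt (H * (p * (H\<^sup>2 * D))) * real Ns powr (- (1 / 4))"
      proof -
        have e1: "real Nt powr (- (1 / 2)) = inverse (sqrt (real Nt))"
          unfolding powr_minus by (subst powr_half_sqrt) auto
        have "real Ns powr (1 / 4) = (real Ns powr (1 / 2)) powr (1 / 2)"
          by (simp add: powr_powr)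
        also have "\<dots> = sqrt (sqrt (real Ns))"
          by (subst powr_half_sqrt, simp)+ simp
        finally have e2: "real Ns powr (- (1 / 4)) = inverse (sqrt (sqrt (real Ns)))"
          unfolding powr_minus by (rule arg_cong)
        show ?thesis
          unfolding e1 e2 real_sqrt_divide by (simp only: divide_inverse)
      qed
      also have "\<dots> \<le> (sqrt (H * C) + sqrt (H * (p * (H\<^sup>2 * D)))) * (real Ns powr (- (1 / 4)) + real Nt powr (- (1 / 2)))"
        using H0 C0 p D0 by (simp add: algebra_simps)
      finally show ?thesis
        using m by (simp add: c_def mult.assoc)
    qed
    have "(\<lambda>(Ns, Nt). expectation (?E Ns Nt))
          \<in> O[sequentially \<times>\<^sub>F sequentially](\<lambda>(Ns, Nt). real Ns powr (- (1 / 4)) + real Nt powr (- (1 / 2)))"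
    proof (rule bigoI[of _ c], rule eventually_prod_sequentially_ge[of 1 2])
      fix Ns Nt :: nat assume N: "1 \<le> Ns" "2 \<le> Nt"
      have "0 \<le> expectation (?E Ns Nt)"
        using E0[OF N] by simp
      then show "norm (case (Ns, Nt) of (Ns, Nt) \<Rightarrow> expectation (?E Ns Nt))
          \<le> c * norm (case (Ns, Nt) of (Ns, Nt) \<Rightarrow> real Ns powr (- (1 / 4)) + real Nt powr (- (1 / 2)))"
        using main[OF N] by simp
    qed
    then show ?thesis using Ei by blast
  qed

  show ?thesis
    using claim1 claim2 claim3 claim4 claim5 by blast
qed

end
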